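(* Let $m,n\ge 1$ be integers with $m+n\ge 3$, let $\Theta\in\mathbb{R}^{n\times m}$, and let $\boldsymbol\sigma=(\sigma_1,\ldots,\sigma_m)$, $\boldsymbol\rho=(\rho_1,\ldots,\rho_n)$ be weights: $\sigma_1\ge\ldots\ge\sigma_m>0$, $\rho_1\ge\ldots\ge\rho_n>0$, $\sum_{j=1}^m\sigma_j=\sum_{i=1}^n\rho_i=1$. Set $\hat\omega=\hat\omega_{\boldsymbol\sigma,\boldsymbol\rho}(\Theta)$ and $\hat\omega^\top=\hat\omega_{\boldsymbol\rho,\boldsymbol\sigma}(\Theta^\top)$, where $\Theta^\top$ is the transposed matrix. Then $$\hat\omega^\top\ \ge\ \begin{cases}\dfrac{1-\sigma_m\hat\omega^{-1}}{1-\sigma_m} & \text{if }\hat\omega\ge\sigma_m/\rho_n,\\[2ex] \dfrac{1-\rho_n}{1-\rho_n\hat\omega} & \text{if }\hat\omega\le\sigma_m/\rho_n.\end{cases}$$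
   Context: For weights $\boldsymbol\sigma\in\mathbb{R}_{>0}^m$, $\boldsymbol\rho\in\mathbb{R}_{>0}^n$ put $|\mathbf x|_{\boldsymbol\sigma}=\max_{1\le j\le m}|x_j|^{1/\sigma_j}$ for $\mathbf x\in\mathbb{R}^m$ and $|\mathbf y|_{\boldsymbol\rho}=\max_{1\le i\le n}|y_i|^{1/\rho_i}$ for $\mathbf y\in\mathbb{R}^n$. For $\Theta\in\mathbb{R}^{n\times m}$ consider the system $$|\mathbf x|_{\boldsymbol\sigma}\le t,\qquad |\Theta\mathbf x-\mathbf y|_{\boldsymbol\rho}\le t^{-\gamma}.\qquad( * )$$ The uniform weighted Diophantine exponent $\hat\omega_{\boldsymbol\sigma,\boldsymbol\rho}(\Theta)\in[1,+\infty]$ is the supremum of real $\gamma$ such that $( * )$ admits nonzero solutions $(\mathbf x,\mathbf y)\in\mathbb{Z}^{m}\times\mathbb{Z}^n$ for every $t$ large enough. The exponent $\hat\omega_{\boldsymbol\rho,\boldsymbol\sigma}(\Theta^\top)$ is obtained from the same definition with $(m,n,\boldsymbol\sigma,\boldsymbol\rho,\Theta)$ replaced by $(n,m,\boldsymbol\rho,\boldsymbol\sigma,\Theta^\top)$. Conventions: $\hat\omega^{-1}=0$ if $\hat\omega=+\infty$; if $m=1$ (so that $\sigma_m=1$) and $\hat\omega\ge\sigma_m/\rho_n=\rho_n^{-1}$, the right-hand side is read as $+\infty$. *)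

theory Defs
  imports "HOL-Analysis.Analysis"
begin

text \<open>
  Vectors and matrices are indexed by finite linearly ordered types, so that the ordering
  condition on the weights makes sense; every size \<open>n \<ge> 1\<close> is realised by such a type
  (for instance by the numeral type \<open>n\<close>).
\<close>

definition weights :: "real ^ 'k::{finite,linorder} \<Rightarrow> bool" where
  "weights \<sigma> \<longleftrightarrow> antimono (\<lambda>j. \<sigma> $ j) \<and> (\<forall>j. \<sigma> $ j > 0) \<and> (\<Sum>j\<in>UNIV. \<sigma> $ j) = 1"

definition last_entry :: "real ^ 'k::{finite,linorder} \<Rightarrow> real" where
  "last_entry \<sigma> = \<sigma> $ Max UNIV"

text \<open>The convention \<open>0 powr a = 0\<close> is the intended value here, since the exponents are positive.\<close>

definition weighted_norm :: "real ^ 'k::finite \<Rightarrow> real ^ 'k \<Rightarrow> real" where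
  "weighted_norm \<sigma> x = (MAX j. \<bar>x $ j\<bar> powr (1 / \<sigma> $ j))"

definition real_vec :: "int ^ 'k \<Rightarrow> real ^ 'k::finite" where
  "real_vec x = (\<chi> j. real_of_int (x $ j))"

definition solvable ::
  "real ^ 'm::finite \<Rightarrow> real ^ 'n::finite \<Rightarrow> real ^ 'm ^ 'n \<Rightarrow> real \<Rightarrow> real \<Rightarrow> bool" where
  "solvable \<sigma> \<rho> \<Theta> \<gamma> t \<longleftrightarrow>
     (\<exists>(x :: int ^ 'm) (y :: int ^ 'n). (x, y) \<noteq> (0, 0) \<and>
        weighted_norm \<sigma> (real_vec x) \<le> t \<and>
        weighted_norm \<rho> (\<Theta> *v real_vec x - real_vec y) \<le> t powr (- \<gamma>))"

definition uniform_exponent ::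
  "real ^ 'm::finite \<Rightarrow> real ^ 'n::finite \<Rightarrow> real ^ 'm ^ 'n \<Rightarrow> ereal" where
  "uniform_exponent \<sigma> \<rho> \<Theta> =
     Sup {ereal \<gamma> | \<gamma>. eventually (\<lambda>t. solvable \<sigma> \<rho> \<Theta> \<gamma> t) at_top}"

end

theory Submission
  imports Defs
begin

text \<open>
Write \<open>\<sigma>\<^sub>m\<close>, \<open>\<rho>\<^sub>n\<close> for the smallest weights and let \<open>\<zeta>(p) = (x, \<Theta> x - y)\<close> and
\<open>\<xi>(q) = (- x' - \<Theta>\<^sup>T y', y')\<close> be the linear forms of the given and of the transposed system; then
\<open>\<zeta>(p) \<bullet> \<xi>(q)\<close> is an integer for integer points \<open>p\<close>, \<open>q\<close>. Fix \<open>1 \<le> g < \<omega>\<close> and let \<open>g' \<ge> 1\<close> satisfy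
\<open>g' (1 - \<sigma>\<^sub>m) \<le> 1 - \<sigma>\<^sub>m / g\<close> and \<open>g' (1 - \<rho>\<^sub>n g) \<le> 1 - \<rho>\<^sub>n\<close>. For every large \<open>T\<close> a nonzero \<open>q\<close> with
\<open>\<xi>(q)\<close> in a constant multiple of the box with sides \<open>T powr (- g' \<sigma>\<^sub>j)\<close> and \<open>T powr \<rho>\<^sub>i\<close> is found
as follows.

Scale the primal forms by these side lengths, so that the supremum norm \<open>N\<close> of the scaled
vector is dual to the box, whose volume is \<open>\<delta> = T powr (1 - g')\<close> up to a constant. The solutions
of the given system for \<open>t\<close> between \<open>T powr (1 / g)\<close> and \<open>T powr g'\<close> have scaled coordinates
at most \<open>V\<close> in \<open>x\<close> and at most \<open>\<delta> / V\<close> in \<open>\<Theta> x - y\<close>, where \<open>V\<close> runs through \<open>[\<delta>, 1]\<close>; the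
logarithms of these bounds are affine in \<open>ln t\<close>, and the two conditions on \<open>g'\<close> are what is needed
at the two ends of the range (\<open>transference_exponents\<close>, \<open>transference_box\<close>). Comparing the first two
successive minima of \<open>N\<close>, one obtains either a nonzero point with \<open>N \<le> 2 \<delta>\<close> or two
independent points whose norms have product at most \<open>2 \<delta>\<close>
(\<open>short_vector_or_independent_pair\<close>). In both cases the dual integer points orthogonal to these one
or two vectors form a lattice of small covolume, and Minkowski's theorem on linear forms
provides one in the required box (\<open>small_dual_vector\<close>); here \<open>m + n \<ge> 3\<close> is used.

Taking \<open>g' = (1 - \<sigma>\<^sub>m / g) / (1 - \<sigma>\<^sub>m)\<close> for \<open>g \<ge> \<sigma>\<^sub>m / \<rho>\<^sub>n\<close> and \<open>g' = (1 - \<rho>\<^sub>n) / (1 - \<rho>\<^sub>n g)\<close> for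
\<open>g \<le> \<sigma>\<^sub>m / \<rho>\<^sub>n\<close> with \<open>\<rho>\<^sub>n g < 1\<close>, and letting \<open>g\<close> tend to \<open>\<omega>\<close>, gives the two cases. If \<open>m = 1\<close>, the second
value tends to infinity as \<open>g\<close> tends to \<open>1 / \<rho>\<^sub>n\<close>. If \<open>\<omega> = 1\<close>, the claim is Dirichlet's
theorem (\<open>solvable_of_less_1\<close>).
\<close>

section \<open>Minkowski's theorem on linear forms\<close>

text \<open>
Points of the \<open>(m + n)\<close>-dimensional space are indexed by a sum type, and the change of variables
formula for linear maps asks for a well-ordered index type. The order chosen on the sum (every
\<open>Inl\<close> below every \<open>Inr\<close>) has no other significance.
\<close>

instantiation sum :: ("{finite,linorder}", "{finite,linorder}") linorder
begin

definition less_eq_sum :: "'a + 'b \<Rightarrow> 'a + 'b \<Rightarrow> bool" where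
  "less_eq_sum u v = (case u of Inl a \<Rightarrow> (case v of Inl b \<Rightarrow> a \<le> b | Inr _ \<Rightarrow> True)
                              | Inr a \<Rightarrow> (case v of Inl _ \<Rightarrow> False | Inr b \<Rightarrow> a \<le> b))"

definition less_sum :: "'a + 'b \<Rightarrow> 'a + 'b \<Rightarrow> bool" where
  "less_sum u v = (u \<le> v \<and> \<not> v \<le> u)"

instance
  by standard (auto simp: less_eq_sum_def less_sum_def split: sum.splits)

end

instance sum :: ("{finite,linorder}", "{finite,linorder}") wellorder
proof
  fix P :: "'a + 'b \<Rightarrow> bool" and a
  assume step: "\<And>x. (\<And>y. y < x \<Longrightarrow> P y) \<Longrightarrow> P x"
  have "wf ({(x, y). y < (x :: 'a + 'b)}\<inverse>)"
    by (rule finite_acyclic_wf_converse)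
       (auto intro: finite_subset[OF subset_UNIV] acyclicI_order[where f = id])
  then show "P a"
    by (rule wf_induct_rule) (use step in auto)
qed

lemma real_vec_nth [simp]: "real_vec x $ k = real_of_int (x $ k)"
  by (simp add: real_vec_def)

lemma real_vec_eq_0_iff [simp]: "real_vec x = 0 \<longleftrightarrow> x = 0"
  by (simp add: vec_eq_iff)

text \<open>
Blichfeldt's principle: cut \<open>S\<close> along the unit cells of the integer lattice and translate all the
pieces into one cell of volume 1; as \<open>S\<close> has volume greater than 1, two pieces overlap.
\<close>

lemma blichfeldt:
  fixes S :: "(real ^ 'd) set"
  assumes S: "S \<in> lmeasurable" and "bounded S" and "measure lebesgue S > 1"
  shows "\<exists>x\<in>S. \<exists>y\<in>S. \<exists>p :: int ^ 'd. p \<noteq> 0 \<and> x - y = real_vec p"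
proof (rule ccontr)
  assume no: "\<not> ?thesis"
  define fl :: "real ^ 'd \<Rightarrow> int ^ 'd" where "fl x = (\<chi> k. \<lfloor>x $ k\<rfloor>)" for x
  define cell where "cell a = {x :: real ^ 'd. \<forall>k. real_of_int (a $ k) \<le> x $ k \<and> x $ k < real_of_int (a $ k) + 1}"
    for a :: "int ^ 'd"
  have cell_iff: "x \<in> cell a \<longleftrightarrow> fl x = a" for x a
    unfolding cell_def fl_def by (auto simp: vec_eq_iff floor_eq_iff) 
  have fin: "finite (fl ` S)"
  proof -
    obtain B where B: "\<And>x. x \<in> S \<Longrightarrow> norm x \<le> B"
      using \<open>bounded S\<close> by (auto simp: bounded_iff)
    have "fl ` S \<subseteq> (\<lambda>f. \<chi> k. f k) ` (UNIV \<rightarrow>\<^sub>E {\<lfloor>-B\<rfloor>..\<lfloor>B\<rfloor>})"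
    proof
      fix a assume "a \<in> fl ` S"
      then obtain x where x: "x \<in> S" "a = fl x" by auto
      have "\<bar>x $ k\<bar> \<le> B" for k
        using component_le_norm_cart[of x k] B[OF x(1)] by linarith
      then have "a $ k \<in> {\<lfloor>-B\<rfloor>..\<lfloor>B\<rfloor>}" for k
        unfolding x fl_def by (auto intro!: floor_mono simp: abs_le_iff) (metis minus_le_iff)
      then show "a \<in> (\<lambda>f. \<chi> k. f k) ` (UNIV \<rightarrow>\<^sub>E {\<lfloor>-B\<rfloor>..\<lfloor>B\<rfloor>})"
        by (intro image_eqI[of _ _ "\<lambda>k. a $ k"]) auto
    qed
    then show ?thesis
      by (rule finite_subset) (intro finite_imageI finite_PiE; simp)
  qed
  have cell_meas: "cell a \<in> sets lebesgue" for a
  proof -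
    have "cell a = (\<Inter>k. {x. real_of_int (a $ k) \<le> x $ k} \<inter> {x. x $ k < real_of_int (a $ k) + 1})"
      by (auto simp: cell_def)
    also have "\<dots> \<in> sets borel"
      by (intro sets.countable_INT'' sets.Int borel_closed borel_open closed_halfspace_component_ge_cart
          open_halfspace_component_lt_cart) auto
    finally show ?thesis by auto
  qed
  have sub: "cell 0 \<subseteq> cbox 0 1"
    by (auto simp: cell_def mem_box_cart less_imp_le)
  have Q: "cell 0 \<in> lmeasurable" "measure lebesgue (cell 0) \<le> 1"
  proof -
    show 1: "cell 0 \<in> lmeasurable"
      using sub cell_meas by (meson bounded_cbox bounded_set_imp_lmeasurable bounded_subset)
    have "measure lebesgue (cell 0) \<le> measure lebesgue (cbox 0 (1 :: real ^ 'd))"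
      by (rule measure_mono_fmeasurable[OF sub]) (use cell_meas in auto)
    also have "\<dots> \<le> 1"
      by (simp add: content_cbox_if_cart)
    finally show "measure lebesgue (cell 0) \<le> 1" .
  qed
  define tr where "tr a = (\<lambda>x. - real_vec a + x) ` (S \<inter> cell a)" for a
  have Sa: "S \<inter> cell a \<in> lmeasurable" for a
    using S cell_meas by (rule fmeasurable_Int_fmeasurable)
  have tr: "tr a \<in> lmeasurable" "measure lebesgue (tr a) = measure lebesgue (S \<inter> cell a)" for a
    unfolding tr_def using Sa measurable_translation measure_translation by blast+
  have S_eq: "S = (\<Union>a\<in>fl ` S. S \<inter> cell a)"
    by (auto simp: cell_iff)
  have "measure lebesgue S = (\<Sum>a\<in>fl ` S. measure lebesgue (S \<inter> cell a))"
    by (subst S_eq, rule measure_UNION'[OF fin])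
       (auto simp: Sa pairwise_def disjnt_def cell_iff)
  also have "\<dots> = (\<Sum>a\<in>fl ` S. measure lebesgue (tr a))"
    by (simp add: tr)
  also have "\<dots> = measure lebesgue (\<Union>a\<in>fl ` S. tr a)"
  proof (rule measure_UNION'[OF fin, symmetric])
    show "pairwise (\<lambda>a b. disjnt (tr a) (tr b)) (fl ` S)"
    proof (clarsimp simp: pairwise_def disjnt_iff)
      fix x y z assume *: "x \<in> S" "y \<in> S" "fl x \<noteq> fl y" "z \<in> tr (fl x)" "z \<in> tr (fl y)"
      then obtain x' y' where "x' \<in> S" "y' \<in> S" "z = - real_vec (fl x) + x'" "z = - real_vec (fl y) + y'"
        by (auto simp: tr_def)
      moreover from this have "x' - y' = real_vec (fl x - fl y)"
        by (auto simp: vec_eq_iff algebra_simps)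
      moreover have "fl x - fl y \<noteq> 0" using * by simp
      ultimately show False using no by blast
    qed
  qed (use tr in auto)
  also have "\<dots> \<le> measure lebesgue (cell 0)"
  proof (rule measure_mono_fmeasurable[OF _ _ Q(1)])
    show "(\<Union>a\<in>fl ` S. tr a) \<subseteq> cell 0"
      by (auto simp: tr_def cell_def algebra_simps)
    show "(\<Union>a\<in>fl ` S. tr a) \<in> sets lebesgue"
      by (intro sets.finite_UN fin fmeasurableD tr)
  qed
  finally show False
    using Q(2) assms(3) by linarith
qed

text \<open>
Minkowski's theorem on linear forms, with the forms given by their inverse: \<open>v\<close> is the vector of
values of the forms at the integer point \<open>p\<close>, and \<open>H\<close> recovers \<open>p\<close> from these values. It is
Blichfeldt's principle for the image under \<open>H\<close> of the box with side lengths \<open>c k\<close>.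
\<close>

lemma minkowski_parallelepiped:
  fixes H :: "real ^ 'd::{finite,wellorder} \<Rightarrow> real ^ 'd::{finite,wellorder}"
  assumes H: "linear H" "\<bar>det (matrix H)\<bar> = 1"
    and c: "\<And>k. c k > (0 :: real)" "(\<Prod>k\<in>UNIV. c k) > 1"
  shows "\<exists>(p :: int ^ 'd::{finite,wellorder}) v. p \<noteq> 0 \<and> real_vec p = H v \<and> (\<forall>k. \<bar>v $ k\<bar> \<le> c k)"
proof -
  define B where "B = cbox (\<chi> k. - c k / 2) (\<chi> k. c k / 2)"
  have "B \<noteq> {}"
    using c(1) unfolding B_def by (auto simp: interval_eq_empty_cart not_less intro: less_imp_le)
  then have "measure lebesgue B = (\<Prod>k\<in>UNIV. c k)"
    unfolding B_def by (simp add: content_cbox_cart)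
  then have "measure lebesgue (H ` B) > 1"
    using H c measure_linear_image[of H B] by (auto simp: B_def)
  moreover have "H ` B \<in> lmeasurable"
    using H(1) by (auto simp: B_def intro: measurable_linear_image)
  moreover have "bounded (H ` B)"
    using H(1) by (auto simp: B_def intro!: bounded_linear_image linear_conv_bounded_linear[THEN iffD1])
  ultimately obtain x y p where
    "x \<in> B" "y \<in> B" "p \<noteq> 0" "H x - H y = real_vec p"
    using blichfeldt[of "H ` B"] by blast
  moreover from this have "\<bar>(x - y) $ k\<bar> \<le> c k" for k
    unfolding B_def mem_box_cart by (simp add: abs_le_iff) (smt (verit) field_sum_of_halves)
  ultimately show ?thesis
    using linear_diff[OF H(1)] by metis
qed

lemma abs_det_involution:
  fixes f :: "real ^ 'd \<Rightarrow> real ^ 'd"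
  assumes "linear f" "\<And>x. f (f x) = x"
  shows "\<bar>det (matrix f)\<bar> = 1"
proof -
  have "f \<circ> f = id" using assms(2) by auto
  then have "matrix f ** matrix f = mat 1"
    using matrix_compose[OF assms(1) assms(1)] by (simp add: matrix_id_mat_1)
  then have "det (matrix f) * det (matrix f) = 1"
    by (metis det_I det_mul)
  then show ?thesis
    by (metis abs_mult_self_eq abs_1 abs_ge_zero abs_mult mult_cancel_left2 power2_eq_1_iff power2_eq_square abs_minus_cancel)
qed

section \<open>Successive minima\<close>

text \<open>
For an integer point \<open>p\<close> let \<open>u\<close> and \<open>v\<close> be the largest values of \<open>\<bar>Z p $ k\<bar> * \<eta> k\<close> over
\<open>k \<notin> A\<close> and over \<open>k \<in> A\<close>, and \<open>N = max u v\<close>. The hypothesis provides nonzero points with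
\<open>v \<le> V\<close> and \<open>u \<le> \<delta> / V\<close> for all \<open>V\<close> in \<open>[\<delta>, 1]\<close>; the conclusion says that, up to the factor 2,
either the first successive minimum of \<open>N\<close> is at most \<open>\<delta>\<close> or the product of the first two is.

The choice \<open>V = sqrt \<delta>\<close> gives points with \<open>N \<le> sqrt \<delta>\<close>; let \<open>p0\<close> be the one among them with
the smallest sum of absolute values of its integer coordinates, and \<open>l = N p0\<close>. If the conclusion
fails, then \<open>l > 2 * \<delta>\<close>, and every \<open>p\<close> with \<open>N p * l \<le> 2 * \<delta>\<close> is a multiple of \<open>p0\<close>. Applying
the hypothesis once more, with \<open>V = l / 2\<close> or \<open>V = 2 * \<delta> / l\<close> according as \<open>l\<close> is attained in \<open>A\<close>
or outside it, yields a multiple of \<open>p0\<close> by a factor of absolute value at most \<open>1 / 2\<close>, which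
contradicts the choice of \<open>p0\<close>.
\<close>

lemma short_vector_or_independent_pair:
  fixes Z :: "real ^ 'd \<Rightarrow> real ^ 'd" and \<eta> :: "'d \<Rightarrow> real"
  assumes Z: "linear Z" and \<eta>: "\<And>k. \<eta> k > 0" and \<delta>: "0 < \<delta>" "\<delta> \<le> 1"
    and boxes: "\<And>V. \<delta> \<le> V \<Longrightarrow> V \<le> 1 \<Longrightarrow> \<exists>p :: int ^ 'd. p \<noteq> 0 \<and>
      (\<forall>k\<in>A. \<bar>Z (real_vec p) $ k\<bar> * \<eta> k \<le> V) \<and> (\<forall>k\<in>-A. \<bar>Z (real_vec p) $ k\<bar> * \<eta> k \<le> \<delta> / V)"
  shows "(\<exists>p :: int ^ 'd. p \<noteq> 0 \<and> (\<forall>k. \<bar>Z (real_vec p) $ k\<bar> * \<eta> k \<le> 2 * \<delta>)) \<or>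
    (\<exists>(p1 :: int ^ 'd) (p2 :: int ^ 'd) N1 N2. p1 \<noteq> 0 \<and> (\<forall>c. real_vec p2 \<noteq> c *\<^sub>R real_vec p1) \<and>
       (\<forall>k. \<bar>Z (real_vec p1) $ k\<bar> * \<eta> k \<le> N1) \<and> (\<forall>k. \<bar>Z (real_vec p2) $ k\<bar> * \<eta> k \<le> N2) \<and>
       N1 * N2 \<le> 2 * \<delta>)"
proof (rule ccontr)
  assume neg: "\<not> ?thesis"
  define h where "h p k = \<bar>Z (real_vec p) $ k\<bar> * \<eta> k" for p :: "int ^ 'd" and k
  define sz where "sz p = (\<Sum>k\<in>UNIV. nat \<bar>p $ k\<bar>)" for p :: "int ^ 'd"
  have sz: "real (sz p) = (\<Sum>k\<in>UNIV. \<bar>real_vec p $ k\<bar>)" for p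
    by (simp add: sz_def)
  define P where "P p \<longleftrightarrow> p \<noteq> 0 \<and> (\<forall>k. h p k \<le> sqrt \<delta>)" for p
  have sq: "\<delta> \<le> sqrt \<delta>" "sqrt \<delta> \<le> 1" "\<delta> / sqrt \<delta> = sqrt \<delta>"
    using \<delta> by (auto simp: real_div_sqrt real_le_rsqrt power2_eq_square mult_left_le)
  obtain p where "P p"
    using boxes[OF sq(1,2)] unfolding sq(3) P_def h_def by (metis ComplI)
  then obtain p0 where p0: "P p0" and p0_min: "\<And>p. P p \<Longrightarrow> sz p0 \<le> sz p"
    using ex_has_least_nat[of P p sz] by blast
  define l where "l = Max (range (h p0))"
  have h_le: "h p0 k \<le> l" for k
    unfolding l_def by (rule Max_ge) auto
  have "l \<in> range (h p0)"
    unfolding l_def by (rule Max_in) auto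
  then obtain k0 where k0: "h p0 k0 = l" by (metis imageE)
  have l: "2 * \<delta> < l" "l \<le> sqrt \<delta>"
  proof -
    show "2 * \<delta> < l"
    proof (rule ccontr)
      assume "\<not> 2 * \<delta> < l"
      then have "h p0 k \<le> 2 * \<delta>" for k using h_le[of k] by linarith
      then have "p0 \<noteq> 0 \<and> (\<forall>k. h p0 k \<le> 2 * \<delta>)"
        using p0 by (simp add: P_def)
      then show False
        using neg unfolding h_def by (meson disjI1)
    qed
    show "l \<le> sqrt \<delta>" using p0 k0 unfolding P_def by blast
  qed
  have l1: "l \<le> 1" using l(2) sq(2) by linarith
  have l2: "l * l \<le> \<delta>"
    using mult_mono[OF l(2) l(2)] l \<delta> by auto
  obtain p where p: "p \<noteq> 0" "\<And>k. h p k \<le> l / 2 \<or> h p k \<le> 2 * \<delta> / l" "h p k0 \<le> l / 2"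
  proof (cases "k0 \<in> A")
    case True
    have *: "\<delta> \<le> l / 2" "l / 2 \<le> 1" "\<delta> / (l / 2) = 2 * \<delta> / l"
      using l l1 \<delta> by auto
    then obtain p :: "int ^ 'd" where "p \<noteq> 0" "\<forall>k\<in>A. h p k \<le> l / 2" "\<forall>k\<in>-A. h p k \<le> 2 * \<delta> / l"
      using boxes[OF *(1,2)] unfolding h_def *(3) by blast
    then show ?thesis using that[of p] True by blast
  next
    case False
    have *: "\<delta> \<le> 2 * \<delta> / l" "2 * \<delta> / l \<le> 1" "\<delta> / (2 * \<delta> / l) = l / 2"
      using l l1 \<delta> by (auto simp: field_simps)
    then obtain p :: "int ^ 'd" where "p \<noteq> 0" "\<forall>k\<in>A. h p k \<le> 2 * \<delta> / l" "\<forall>k\<in>-A. h p k \<le> l / 2"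
      using boxes[OF *(1,2)] unfolding h_def *(3) by blast
    then show ?thesis using that[of p] False by blast
  qed
  have "h p k \<le> 2 * \<delta> / l" for k
    using p(2)[of k]
  proof
    assume "h p k \<le> l / 2"
    also have "l / 2 \<le> 2 * \<delta> / l" using l2 l \<delta> by (simp add: field_simps)
    finally show ?thesis .
  qed
  moreover have "l * (2 * \<delta> / l) \<le> 2 * \<delta>" using l \<delta> by simp
  ultimately obtain c where c: "real_vec p = c *\<^sub>R real_vec p0"
    using neg h_le p0 unfolding P_def h_def by blast
  have hc: "h p k = \<bar>c\<bar> * h p0 k" for k
    unfolding h_def c using Z by (simp add: linear_scale abs_mult)
  have "\<bar>c\<bar> \<le> 1 / 2"
    using p(3) k0 l \<delta> unfolding hc by (simp add: field_simps)
  have "h p k \<le> sqrt \<delta>" for k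
  proof -
    have "h p0 k \<ge> 0" using \<eta>[of k] by (simp add: h_def)
    then have "h p k \<le> 1 * h p0 k"
      unfolding hc using \<open>\<bar>c\<bar> \<le> 1 / 2\<close> by (intro mult_right_mono) auto
    also have "\<dots> \<le> sqrt \<delta>" using p0 by (simp add: P_def)
    finally show ?thesis .
  qed
  then have "P p" using p(1) by (simp add: P_def)
  have "real (sz p0) \<noteq> 0"
  proof
    assume "real (sz p0) = 0"
    then have "\<forall>k. p0 $ k = 0"
      unfolding sz by (subst (asm) sum_nonneg_eq_0_iff) auto
    then show False
      using p0 unfolding P_def by (auto simp: vec_eq_iff)
  qed
  moreover have "real (sz p) = \<bar>c\<bar> * real (sz p0)"
    unfolding sz c by (simp add: abs_mult sum_distrib_left)
  moreover have "\<bar>c\<bar> * real (sz p0) \<le> 1 / 2 * real (sz p0)"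
    using \<open>\<bar>c\<bar> \<le> 1 / 2\<close> by (intro mult_right_mono) auto
  moreover have "sz p0 \<le> sz p" using p0_min \<open>P p\<close> .
  ultimately show False by linarith
qed

section \<open>Dual lattice points orthogonal to short vectors\<close>

text \<open>
The linear map which replaces the coordinate \<open>w $ a\<close> by \<open>- (w \<bullet> z) / z $ a\<close> and keeps all other
coordinates; it is meant for \<open>z $ a \<noteq> 0\<close>. Up to sign and scale it makes the linear form
\<open>w \<bullet> z\<close> the new coordinate at \<open>a\<close>; the sign is chosen so that the map is an involution, which
makes it volume preserving by \<open>abs_det_involution\<close>.
\<close>

definition reflection :: "real ^ 'd \<Rightarrow> 'd \<Rightarrow> real ^ 'd \<Rightarrow> real ^ 'd" where
  "reflection z a w = w - (w $ a + (w \<bullet> z) / z $ a) *\<^sub>R axis a 1"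

lemma linear_reflection: "linear (reflection z a)"
  by (rule linearI) (auto simp: reflection_def inner_add_left algebra_simps add_divide_distrib)

lemma reflection_nth_other: "k \<noteq> a \<Longrightarrow> reflection z a w $ k = w $ k"
  by (simp add: reflection_def axis_def)

lemma inner_reflection: "z $ a \<noteq> 0 \<Longrightarrow> reflection z a w \<bullet> z = - (w $ a * z $ a)"
  by (simp add: reflection_def inner_diff_left inner_axis' algebra_simps)

lemma inner_reflection_other: "y $ a = 0 \<Longrightarrow> reflection z a w \<bullet> y = w \<bullet> y"
  by (simp add: reflection_def inner_diff_left inner_axis')

lemma reflection_reflection: "z $ a \<noteq> 0 \<Longrightarrow> reflection z a (reflection z a w) = w"
  by (subst reflection_def, subst inner_reflection)
     (auto simp: reflection_def vec_eq_iff axis_def)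

text \<open>
Minkowski's theorem for the coordinates of \<open>E q\<close> other than \<open>a\<close> and \<open>b\<close> together with the two
linear forms \<open>E q \<bullet> y\<close> and \<open>E q \<bullet> z\<close>. As \<open>z $ a = 0\<close>, this system of forms is triangular,
with determinant \<open>y $ a * z $ b\<close> up to sign. Since the dimension is at least 3, the factor \<open>K\<close>
enters the volume to a power of at least 1.
\<close>

lemma minkowski_two_pivots:
  fixes E :: "real ^ 'd::{finite,wellorder} \<Rightarrow> real ^ 'd::{finite,wellorder}"
  assumes E: "linear E" "\<And>x. E (E x) = x"
    and \<eta>: "\<And>k. \<eta> k > (0 :: real)" and K: "K \<ge> 1" and d: "CARD('d) \<ge> 3"
    and ab: "a \<noteq> b" "y $ a \<noteq> 0" "z $ b \<noteq> 0" "z $ a = 0"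
    and vol: "4 * (\<bar>y $ a\<bar> * \<eta> a) * (\<bar>z $ b\<bar> * \<eta> b) < K * (\<Prod>k\<in>UNIV. \<eta> k)"
  obtains q where "q \<noteq> 0" "\<bar>E (real_vec q) \<bullet> y\<bar> \<le> 1 / 2" "\<bar>E (real_vec q) \<bullet> z\<bar> \<le> 1 / 2"
    "\<And>k. k \<noteq> a \<Longrightarrow> k \<noteq> b \<Longrightarrow> \<bar>E (real_vec q) $ k\<bar> \<le> K * \<eta> k"
proof -
  define c where "c k = (if k = a then 1 / (2 * \<bar>y $ a\<bar>) else if k = b then 1 / (2 * \<bar>z $ b\<bar>) else K * \<eta> k)" for k
  let ?R = "UNIV - {a, b}"
  have split: "(\<Prod>k\<in>UNIV. f k) = f a * f b * (\<Prod>k\<in>?R. f k)" for f :: "'d \<Rightarrow> real"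
  proof -
    have "(\<Prod>k\<in>UNIV. f k) = f a * (\<Prod>k\<in>UNIV - {a}. f k)"
      by (rule prod.remove) auto
    also have "(\<Prod>k\<in>UNIV - {a}. f k) = f b * (\<Prod>k\<in>UNIV - {a} - {b}. f k)"
      by (rule prod.remove) (use ab in auto)
    finally show ?thesis by (simp add: insert_Diff_if Diff_insert2[symmetric] mult.assoc)
  qed
  have card: "card ?R \<ge> 1"
    using d ab by (simp add: card_Diff_subset)
  have "K ^ 1 \<le> K ^ card ?R"
    using K card by (rule power_increasing[rotated])
  have pos: "(\<Prod>k\<in>?R. \<eta> k) > 0" using \<eta> by (simp add: prod_pos)
  have "4 * \<bar>y $ a\<bar> * \<bar>z $ b\<bar> * (\<eta> a * \<eta> b) < K * (\<Prod>k\<in>?R. \<eta> k) * (\<eta> a * \<eta> b)"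
    using vol split[of \<eta>] by (simp add: mult_ac)
  then have "4 * \<bar>y $ a\<bar> * \<bar>z $ b\<bar> < K * (\<Prod>k\<in>?R. \<eta> k)"
    using \<eta>[of a] \<eta>[of b] by (simp add: mult_less_cancel_right)
  also have "\<dots> \<le> K ^ card ?R * (\<Prod>k\<in>?R. \<eta> k)"
    using \<open>K ^ 1 \<le> K ^ card ?R\<close> pos by (intro mult_right_mono) auto
  also have "\<dots> = (\<Prod>k\<in>?R. c k)"
    by (simp add: c_def prod.distrib)
  finally have "1 < (\<Prod>k\<in>UNIV. c k)"
    unfolding split[of c] using ab by (simp add: c_def field_simps)
  moreover have "c k > 0" for k
    using ab \<eta>[of k] K by (simp add: c_def)
  moreover define H where "H = E \<circ> (reflection y a \<circ> reflection z b)"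
  moreover have "linear H"
    unfolding H_def by (intro linear_compose E linear_reflection)
  moreover have "\<bar>det (matrix H)\<bar> = 1"
    unfolding H_def using ab E
    by (simp add: matrix_compose linear_compose linear_reflection det_mul abs_mult
        abs_det_involution reflection_reflection)
  ultimately obtain q v where q: "q \<noteq> 0" "real_vec q = H v" and v: "\<And>k. \<bar>v $ k\<bar> \<le> c k"
    using minkowski_parallelepiped[of H c] by blast
  have w: "E (real_vec q) = reflection y a (reflection z b v)"
    unfolding q H_def by (simp add: E)
  show thesis
  proof (rule that[OF q(1)])
    have "\<bar>v $ a\<bar> * \<bar>y $ a\<bar> \<le> 1 / 2"
      using v[of a] ab by (simp add: c_def field_simps)
    then show "\<bar>E (real_vec q) \<bullet> y\<bar> \<le> 1 / 2"
      unfolding w using ab by (simp add: inner_reflection reflection_nth_other abs_mult)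
    have "\<bar>v $ b\<bar> * \<bar>z $ b\<bar> \<le> 1 / 2"
      using v[of b] ab by (simp add: c_def field_simps)
    then show "\<bar>E (real_vec q) \<bullet> z\<bar> \<le> 1 / 2"
      unfolding w using ab by (simp add: inner_reflection inner_reflection_other abs_mult)
    show "\<bar>E (real_vec q) $ k\<bar> \<le> K * \<eta> k" if "k \<noteq> a" "k \<noteq> b" for k
      using v[of k] that unfolding w by (simp add: reflection_nth_other c_def)
  qed
qed

text \<open>
If \<open>w\<close> is orthogonal to \<open>z\<close>, then its coordinate at the position where \<open>\<bar>z $ k\<bar> * \<eta> k\<close> is
largest is controlled by the other ones.
\<close>

lemma pivot_coordinate_bound:
  fixes w z :: "real ^ 'd"
  assumes "w \<bullet> z = 0" "z $ a \<noteq> 0" and pivot: "\<And>k. \<bar>z $ k\<bar> * \<eta> k \<le> \<bar>z $ a\<bar> * \<eta> a"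
    and w: "\<And>k. k \<noteq> a \<Longrightarrow> z $ k \<noteq> 0 \<Longrightarrow> \<bar>w $ k\<bar> \<le> C * \<eta> k" and C: "C \<ge> 0" and \<eta>: "\<eta> a > 0"
  shows "\<bar>w $ a\<bar> \<le> real CARD('d) * C * \<eta> a"
proof -
  have "(\<Sum>k\<in>UNIV. w $ k * z $ k) = w $ a * z $ a + (\<Sum>k\<in>UNIV - {a}. w $ k * z $ k)"
    by (rule sum.remove) auto
  then have "w $ a * z $ a = - (\<Sum>k\<in>UNIV - {a}. w $ k * z $ k)"
    using assms(1) by (simp add: inner_vec_def)
  then have "\<bar>w $ a\<bar> * \<bar>z $ a\<bar> = \<bar>\<Sum>k\<in>UNIV - {a}. w $ k * z $ k\<bar>"
    by (simp add: abs_mult[symmetric])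
  also have "\<dots> \<le> (\<Sum>k\<in>UNIV - {a}. C * (\<bar>z $ a\<bar> * \<eta> a))"
  proof (rule sum_abs[THEN order_trans], rule sum_mono)
    fix k assume k: "k \<in> UNIV - {a}"
    show "\<bar>w $ k * z $ k\<bar> \<le> C * (\<bar>z $ a\<bar> * \<eta> a)"
    proof (cases "z $ k = 0")
      case True
      then show ?thesis using C \<eta> by simp
    next
      case False
      have "\<bar>w $ k * z $ k\<bar> \<le> C * \<eta> k * \<bar>z $ k\<bar>"
        unfolding abs_mult using w[of k] k False by (intro mult_right_mono) auto
      also have "\<dots> = C * (\<bar>z $ k\<bar> * \<eta> k)" by simp
      also have "\<dots> \<le> C * (\<bar>z $ a\<bar> * \<eta> a)"
        using pivot C by (rule mult_left_mono)
      finally show ?thesis .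
    qed
  qed
  also have "\<dots> = real (card (UNIV - {a} :: 'd set)) * (C * (\<bar>z $ a\<bar> * \<eta> a))"
    by simp
  also have "\<dots> \<le> real CARD('d) * (C * (\<bar>z $ a\<bar> * \<eta> a))"
    using C \<eta> by (intro mult_right_mono of_nat_mono card_mono mult_nonneg_nonneg) auto
  finally have "\<bar>w $ a\<bar> * \<bar>z $ a\<bar> \<le> (real CARD('d) * C * \<eta> a) * \<bar>z $ a\<bar>"
    by (simp add: mult_ac)
  then show ?thesis using assms(2) by (simp add: mult_le_cancel_right)
qed

lemma ex_pivot:
  fixes z :: "real ^ 'd"
  assumes "z \<noteq> 0" "\<And>k. \<eta> k > 0"
  obtains a where "z $ a \<noteq> 0" "\<And>k. \<bar>z $ k\<bar> * \<eta> k \<le> \<bar>z $ a\<bar> * \<eta> a"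
proof -
  let ?h = "\<lambda>k. \<bar>z $ k\<bar> * \<eta> k"
  have "Max (range ?h) \<in> range ?h" by (rule Max_in) auto
  then obtain a where max: "Max (range ?h) = ?h a" by (rule imageE)
  have a: "?h k \<le> ?h a" for k
    unfolding max[symmetric] by (rule Max_ge) auto
  obtain k where "z $ k \<noteq> 0" using assms(1) by (auto simp: vec_eq_iff)
  then have "\<bar>z $ k\<bar> * \<eta> k > 0" using assms(2) by simp
  with a[of k] have "z $ a \<noteq> 0" by auto
  with a that show thesis by blast
qed

lemma Ints_abs_half_eq_0: "x \<in> \<int> \<Longrightarrow> \<bar>x\<bar> \<le> 1 / 2 \<Longrightarrow> x = (0 :: real)"
  using Ints_nonzero_abs_ge1[of x] by fastforce

text \<open>
The transference step. Here \<open>Z\<close> and \<open>E\<close> are the primal and the dual system of linear forms, whose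
inner products at integer points are integers. Given a primal integer point \<open>p\<close> with
\<open>\<bar>Z p $ k\<bar> * \<eta> k \<le> 2 * \<delta>\<close>, or independent points \<open>p1\<close>, \<open>p2\<close> with bounds whose product is at
most \<open>2 * \<delta>\<close>, where \<open>\<delta>\<close> is the product of all \<open>\<eta> k\<close>, one looks for a dual integer point
orthogonal to \<open>Z p\<close>, respectively to \<open>Z p1\<close> and \<open>Z p2\<close>: Minkowski's theorem makes the integral
inner products smaller than 1, hence zero, and bounds all coordinates except the pivots;
orthogonality then bounds the pivot coordinates.
\<close>

lemma small_dual_vector:
  fixes E Z :: "real ^ 'd::{finite,wellorder} \<Rightarrow> real ^ 'd::{finite,wellorder}"
  assumes E: "linear E" "\<And>x. E (E x) = x" and Z: "linear Z" "\<And>x. Z x = 0 \<Longrightarrow> x = 0"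
    and pair: "\<And>p q. E (real_vec q) \<bullet> Z (real_vec p) \<in> \<int>"
    and \<eta>: "\<And>k. \<eta> k > (0 :: real)" and d: "CARD('d) \<ge> 3"
    and \<delta>: "(\<Prod>k\<in>UNIV. \<eta> k) \<le> 1"
    and boxes: "\<And>V. (\<Prod>k\<in>UNIV. \<eta> k) \<le> V \<Longrightarrow> V \<le> 1 \<Longrightarrow> \<exists>p. p \<noteq> 0 \<and>
      (\<forall>k\<in>A. \<bar>Z (real_vec p) $ k\<bar> * \<eta> k \<le> V) \<and>
      (\<forall>k\<in>-A. \<bar>Z (real_vec p) $ k\<bar> * \<eta> k \<le> (\<Prod>k\<in>UNIV. \<eta> k) / V)"
  shows "\<exists>q. q \<noteq> 0 \<and> (\<forall>k. \<bar>E (real_vec q) $ k\<bar> \<le> 17 * (real CARD('d))\<^sup>2 * \<eta> k)"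
proof -
  define \<delta> where "\<delta> = (\<Prod>k\<in>UNIV. \<eta> k)"
  define D where "D = real CARD('d)"
  have D: "D \<ge> 1" using d by (simp add: D_def)
  have "D * D \<ge> D" using mult_right_mono[OF D, of D] D by simp
  have \<delta>0: "\<delta> > 0" unfolding \<delta>_def using \<eta> by (simp add: prod_pos)
  have finish: "\<bar>w $ k\<bar> \<le> 17 * D\<^sup>2 * \<eta> k"
    if y: "y $ a \<noteq> 0" "\<And>k. \<bar>y $ k\<bar> * \<eta> k \<le> \<bar>y $ a\<bar> * \<eta> a" "w \<bullet> y = 0"
      and w: "\<bar>w $ b\<bar> \<le> 17 * D * \<eta> b" "\<And>k. k \<noteq> a \<Longrightarrow> k \<noteq> b \<Longrightarrow> \<bar>w $ k\<bar> \<le> 17 * \<eta> k" for w y a b k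
  proof -
    have le: "\<bar>w $ k\<bar> \<le> (17 * D) * \<eta> k" if "k \<noteq> a" for k
    proof (cases "k = b")
      case False
      have "17 * \<eta> k \<le> (17 * D) * \<eta> k"
        using D \<eta>[of k] by (intro mult_right_mono) auto
      with w(2)[OF that False] show ?thesis by (meson order_trans)
    qed (use w(1) in simp)
    show ?thesis
    proof (cases "k = a")
      case True
      have "\<bar>w $ a\<bar> \<le> D * (17 * D) * \<eta> a"
        unfolding D_def
        by (rule pivot_coordinate_bound[OF y(3) y(1,2) le[unfolded D_def]]) (use \<eta> in auto)
      also have "D * (17 * D) = 17 * D\<^sup>2" by (simp add: power2_eq_square)
      finally show ?thesis using True by simp
    next
      case False
      have "17 * D * \<eta> k \<le> 17 * D\<^sup>2 * \<eta> k"
        using \<open>D * D \<ge> D\<close> \<eta>[of k] by (intro mult_right_mono) (auto simp: power2_eq_square)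
      with le[OF False] show ?thesis by linarith
    qed
  qed
  consider p where "p \<noteq> 0" "\<And>k. \<bar>Z (real_vec p) $ k\<bar> * \<eta> k \<le> 2 * \<delta>"
    | p1 p2 N1 N2 where "p1 \<noteq> 0" "\<And>c. real_vec p2 \<noteq> c *\<^sub>R real_vec p1"
       "\<And>k. \<bar>Z (real_vec p1) $ k\<bar> * \<eta> k \<le> N1" "\<And>k. \<bar>Z (real_vec p2) $ k\<bar> * \<eta> k \<le> N2"
       "N1 * N2 \<le> 2 * \<delta>"
    using short_vector_or_independent_pair[OF Z(1) \<eta> \<delta>0 _ boxes[folded \<delta>_def]] \<delta>[folded \<delta>_def]
    by metis
  then show ?thesis
  proof cases
    case 1
    define y where "y = Z (real_vec p)"
    have "y \<noteq> 0" using Z(2) 1(1) unfolding y_def by (metis real_vec_eq_0_iff)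
    then obtain a where a: "y $ a \<noteq> 0" "\<And>k. \<bar>y $ k\<bar> * \<eta> k \<le> \<bar>y $ a\<bar> * \<eta> a"
      using ex_pivot \<eta> by blast
    obtain b where b: "b \<noteq> a"
    proof -
      have "UNIV \<noteq> {a}"
      proof
        assume U: "UNIV = {a}"
        show False using d unfolding U by simp
      qed
      then show thesis using that by blast
    qed
    \<comment> \<open>A single short vector leaves the second form free: it is used to bound the coordinate at \<open>b\<close>.\<close>
    define z :: "real ^ 'd::{finite,wellorder}" where "z = axis b (1 / \<eta> b)"
    have z: "z $ b = 1 / \<eta> b" "z $ a = 0" using b by (auto simp: z_def axis_def)
    have "4 * (\<bar>y $ a\<bar> * \<eta> a) * (\<bar>z $ b\<bar> * \<eta> b) \<le> 4 * (2 * \<delta>)"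
      using 1(2)[of a] \<eta>[of b] by (simp add: z y_def mult.commute)
    also have "\<dots> < 17 * (\<Prod>k\<in>UNIV. \<eta> k)"
      using \<delta>0 unfolding \<delta>_def by linarith
    finally have vol: "4 * (\<bar>y $ a\<bar> * \<eta> a) * (\<bar>z $ b\<bar> * \<eta> b) < 17 * (\<Prod>k\<in>UNIV. \<eta> k)" .
    obtain q where q: "q \<noteq> 0" "\<bar>E (real_vec q) \<bullet> y\<bar> \<le> 1 / 2" "\<bar>E (real_vec q) \<bullet> z\<bar> \<le> 1 / 2"
      "\<And>k. k \<noteq> a \<Longrightarrow> k \<noteq> b \<Longrightarrow> \<bar>E (real_vec q) $ k\<bar> \<le> 17 * \<eta> k"
      by (rule minkowski_two_pivots[OF E \<eta> _ d b[symmetric] a(1) _ z(2) vol])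
         (use z \<eta>[of b] in auto)
    define w where "w = E (real_vec q)"
    have "w \<bullet> y = 0"
      using Ints_abs_half_eq_0 q(2) pair unfolding y_def w_def by blast
    moreover have "\<bar>w $ b\<bar> \<le> 1 / 2 * \<eta> b"
      using q(3) \<eta>[of b] unfolding z_def w_def[symmetric] by (simp add: inner_axis field_simps abs_mult)
    then have "\<bar>w $ b\<bar> \<le> 17 * D * \<eta> b"
      using mult_right_mono[of "1 / 2" "17 * D" "\<eta> b"] D \<eta>[of b] by linarith
    ultimately have "\<bar>w $ k\<bar> \<le> 17 * D\<^sup>2 * \<eta> k" for k
      by (intro finish[of y a w b k] a q(4)[folded w_def])
    then show ?thesis using q(1) unfolding w_def D_def by blast
  next
    case 2
    define y where "y = Z (real_vec p1)"
    have "y \<noteq> 0" using Z(2) 2(1) unfolding y_def by (metis real_vec_eq_0_iff)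
    then obtain a where a: "y $ a \<noteq> 0" "\<And>k. \<bar>y $ k\<bar> * \<eta> k \<le> \<bar>y $ a\<bar> * \<eta> a"
      using ex_pivot \<eta> by blast
    define x where "x = Z (real_vec p2)"
    define r where "r = x $ a / y $ a"
    \<comment> \<open>One step of Gaussian elimination, so that the two forms become triangular.\<close>
    define z where "z = x - r *\<^sub>R y"
    have "z = Z (real_vec p2 - r *\<^sub>R real_vec p1)"
      unfolding z_def x_def y_def using Z(1) by (simp add: linear_diff linear_scale)
    then have "z \<noteq> 0" using Z(2) 2(2)[of r] by (metis right_minus_eq)
    then obtain b where b: "z $ b \<noteq> 0" "\<And>k. \<bar>z $ k\<bar> * \<eta> k \<le> \<bar>z $ b\<bar> * \<eta> b"
      using ex_pivot \<eta> by blast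
    have za: "z $ a = 0" using a unfolding z_def r_def by simp
    then have ab: "a \<noteq> b" using b by auto
    have "\<bar>r\<bar> * (\<bar>y $ b\<bar> * \<eta> b) \<le> \<bar>r\<bar> * (\<bar>y $ a\<bar> * \<eta> a)"
      using a(2) by (intro mult_left_mono) auto
    also have "\<dots> = \<bar>x $ a\<bar> * \<eta> a" using a by (simp add: r_def)
    also have "\<dots> \<le> N2" using 2(4) by (simp add: x_def)
    finally have "\<bar>r\<bar> * (\<bar>y $ b\<bar> * \<eta> b) \<le> N2" .
    moreover have "\<bar>x $ b\<bar> * \<eta> b \<le> N2" using 2(4) by (simp add: x_def)
    moreover have "\<bar>z $ b\<bar> * \<eta> b \<le> (\<bar>x $ b\<bar> + \<bar>r\<bar> * \<bar>y $ b\<bar>) * \<eta> b"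
      using \<eta>[of b] by (intro mult_right_mono) (auto simp: z_def abs_mult[symmetric])
    ultimately have zb: "\<bar>z $ b\<bar> * \<eta> b \<le> 2 * N2"
      by (simp add: algebra_simps)
    have ya: "\<bar>y $ a\<bar> * \<eta> a \<le> N1" using 2(3) by (simp add: y_def)
    have "0 \<le> \<bar>y $ a\<bar> * \<eta> a" "0 \<le> \<bar>z $ b\<bar> * \<eta> b"
      using \<eta>[of a] \<eta>[of b] by auto
    then have "(\<bar>y $ a\<bar> * \<eta> a) * (\<bar>z $ b\<bar> * \<eta> b) \<le> N1 * (2 * N2)"
      using mult_mono[OF ya zb] ya by linarith
    then have "4 * (\<bar>y $ a\<bar> * \<eta> a) * (\<bar>z $ b\<bar> * \<eta> b) < 17 * (\<Prod>k\<in>UNIV. \<eta> k)"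
      using 2(5) \<delta>0 unfolding \<delta>_def by linarith
    then obtain q where q: "q \<noteq> 0" "\<bar>E (real_vec q) \<bullet> y\<bar> \<le> 1 / 2" "\<bar>E (real_vec q) \<bullet> z\<bar> \<le> 1 / 2"
      "\<And>k. k \<noteq> a \<Longrightarrow> k \<noteq> b \<Longrightarrow> \<bar>E (real_vec q) $ k\<bar> \<le> 17 * \<eta> k"
      by (rule minkowski_two_pivots[OF E \<eta> _ d ab a(1) b(1) za, of 17, rotated]) auto
    define w where "w = E (real_vec q)"
    have wy: "w \<bullet> y = 0"
      using Ints_abs_half_eq_0 q(2) pair unfolding y_def w_def by blast
    \<comment> \<open>Only \<open>x\<close>, not \<open>z\<close>, is integral against \<open>w\<close>; the two inner products agree as \<open>w \<bullet> y = 0\<close>.\<close>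
    have "w \<bullet> z = w \<bullet> x"
      using wy by (simp add: z_def inner_diff_right)
    then have wz: "w \<bullet> z = 0"
      using Ints_abs_half_eq_0 q(3) pair unfolding x_def w_def by metis
    have "\<bar>w $ b\<bar> \<le> D * 17 * \<eta> b"
      unfolding D_def
    proof (rule pivot_coordinate_bound[OF wz b])
      show "\<bar>w $ k\<bar> \<le> 17 * \<eta> k" if "k \<noteq> b" "z $ k \<noteq> 0" for k
        using q(4)[of k] that za unfolding w_def by metis
    qed (use \<eta> in auto)
    then have "\<bar>w $ b\<bar> \<le> 17 * D * \<eta> b" by simp
    then have "\<bar>w $ k\<bar> \<le> 17 * D\<^sup>2 * \<eta> k" for k
      by (intro finish[of y a w b k] a wy q(4)[folded w_def])
    then show ?thesis using q(1) unfolding w_def D_def by blast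
  qed
qed

section \<open>The primal and the dual system of linear forms\<close>

text \<open>
For \<open>p = (x, y)\<close>, with \<open>x\<close> stored at \<open>Inl\<close> and \<open>y\<close> at \<open>Inr\<close>, this is the vector
\<open>(x, \<Theta> x - y)\<close> of the linear forms of the given system.
\<close>

definition primal_forms :: "real ^ 'm ^ 'n \<Rightarrow> real ^ ('m + 'n) \<Rightarrow> real ^ ('m + 'n)" where
  "primal_forms \<Theta> p = (\<chi> k. case k of Inl j \<Rightarrow> p $ Inl j
     | Inr i \<Rightarrow> (\<Sum>j\<in>UNIV. \<Theta> $ i $ j * p $ Inl j) - p $ Inr i)"

text \<open>
For \<open>q = (x', y')\<close> this is \<open>(- x' - \<Theta>\<^sup>T y', y')\<close>: up to sign, the linear forms of the transposed
system at its integer point \<open>(y', - x')\<close>. With these signs both systems of forms are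
involutions, and their inner product is the integer \<open>- (q \<bullet> p)\<close>.
\<close>

definition dual_forms :: "real ^ 'm ^ 'n \<Rightarrow> real ^ ('m + 'n) \<Rightarrow> real ^ ('m + 'n)" where
  "dual_forms \<Theta> q = (\<chi> k. case k of Inr i \<Rightarrow> q $ Inr i
     | Inl j \<Rightarrow> - q $ Inl j - (\<Sum>i\<in>UNIV. \<Theta> $ i $ j * q $ Inr i))"

lemma forms_nth [simp]:
  "primal_forms \<Theta> p $ Inl j = p $ Inl j"
  "primal_forms \<Theta> p $ Inr i = (\<Sum>j\<in>UNIV. \<Theta> $ i $ j * p $ Inl j) - p $ Inr i"
  "dual_forms \<Theta> q $ Inr i = q $ Inr i"
  "dual_forms \<Theta> q $ Inl j = - q $ Inl j - (\<Sum>i\<in>UNIV. \<Theta> $ i $ j * q $ Inr i)"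
  by (simp_all add: primal_forms_def dual_forms_def)

lemma vec_eq_sum_iff:
  fixes x y :: "'a ^ ('m::finite + 'n::finite)"
  shows "x = y \<longleftrightarrow> (\<forall>j. x $ Inl j = y $ Inl j) \<and> (\<forall>i. x $ Inr i = y $ Inr i)"
  by (auto simp: vec_eq_iff) (metis sum.exhaust)

lemma sum_UNIV_sum: "(\<Sum>k\<in>UNIV. f k) = (\<Sum>j\<in>UNIV. f (Inl j)) + (\<Sum>i\<in>UNIV. f (Inr i))"
  for f :: "'m::finite + 'n::finite \<Rightarrow> real"
  by (subst UNIV_Plus_UNIV[symmetric], subst sum.Plus) (auto simp: o_def)

lemma prod_UNIV_sum: "(\<Prod>k\<in>UNIV. f k) = (\<Prod>j\<in>UNIV. f (Inl j)) * (\<Prod>i\<in>UNIV. f (Inr i))"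
  for f :: "'m::finite + 'n::finite \<Rightarrow> real"
  by (subst UNIV_Plus_UNIV[symmetric], subst prod.Plus) (auto simp: o_def)

lemma linear_primal_forms: "linear (primal_forms \<Theta>)"
  by (rule linearI) (auto simp: vec_eq_sum_iff algebra_simps sum.distrib sum_distrib_left)

lemma linear_dual_forms: "linear (dual_forms \<Theta>)"
  by (rule linearI) (auto simp: vec_eq_sum_iff algebra_simps sum.distrib sum_distrib_left)

lemma primal_forms_involution: "primal_forms \<Theta> (primal_forms \<Theta> p) = p"
  by (simp add: vec_eq_sum_iff)

lemma dual_forms_involution: "dual_forms \<Theta> (dual_forms \<Theta> q) = q"
  by (simp add: vec_eq_sum_iff)

lemma dual_forms_inner_primal_forms: "dual_forms \<Theta> q \<bullet> primal_forms \<Theta> p = - (q \<bullet> p)"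
proof -
  have "(\<Sum>j\<in>UNIV. (\<Sum>i\<in>UNIV. \<Theta> $ i $ j * q $ Inr i) * p $ Inl j)
      = (\<Sum>i\<in>UNIV. q $ Inr i * (\<Sum>j\<in>UNIV. \<Theta> $ i $ j * p $ Inl j))"
    unfolding sum_distrib_left sum_distrib_right by (subst sum.swap) (simp add: mult_ac)
  then show ?thesis
    by (simp add: inner_vec_def sum_UNIV_sum left_diff_distrib right_diff_distrib sum_subtractf sum_negf)
qed

lemma inner_real_vec_Ints: "real_vec q \<bullet> real_vec p \<in> \<int>"
  by (auto simp: inner_vec_def intro!: Ints_sum)

lemma weighted_norm_le_iff:
  assumes "\<And>j. \<sigma> $ j > 0" "t \<ge> 0"
  shows "weighted_norm \<sigma> x \<le> t \<longleftrightarrow> (\<forall>j. \<bar>x $ j\<bar> \<le> t powr (\<sigma> $ j))"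
proof -
  have "\<bar>x $ j\<bar> powr (1 / \<sigma> $ j) \<le> t \<longleftrightarrow> \<bar>x $ j\<bar> \<le> t powr (\<sigma> $ j)" for j
  proof
    assume "\<bar>x $ j\<bar> powr (1 / \<sigma> $ j) \<le> t"
    then have "(\<bar>x $ j\<bar> powr (1 / \<sigma> $ j)) powr (\<sigma> $ j) \<le> t powr (\<sigma> $ j)"
      using assms(1)[of j] by (intro powr_mono2) auto
    then show "\<bar>x $ j\<bar> \<le> t powr (\<sigma> $ j)"
      using assms(1)[of j] by (simp add: powr_powr)
  next
    assume "\<bar>x $ j\<bar> \<le> t powr (\<sigma> $ j)"
    then have "\<bar>x $ j\<bar> powr (1 / \<sigma> $ j) \<le> (t powr (\<sigma> $ j)) powr (1 / \<sigma> $ j)"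
      using assms(1)[of j] by (intro powr_mono2) auto
    then show "\<bar>x $ j\<bar> powr (1 / \<sigma> $ j) \<le> t"
      using assms(1)[of j] assms(2) by (simp add: powr_powr)
  qed
  then show ?thesis
    unfolding weighted_norm_def by (subst Max_le_iff) auto
qed

lemma solvable_iff_primal_forms:
  assumes "\<And>j. \<sigma> $ j > 0" "\<And>i. \<rho> $ i > 0" "t > 0"
  shows "solvable \<sigma> \<rho> \<Theta> \<gamma> t \<longleftrightarrow> (\<exists>p. p \<noteq> 0 \<and>
    (\<forall>j. \<bar>primal_forms \<Theta> (real_vec p) $ Inl j\<bar> \<le> t powr (\<sigma> $ j)) \<and>
    (\<forall>i. \<bar>primal_forms \<Theta> (real_vec p) $ Inr i\<bar> \<le> t powr (- \<gamma> * \<rho> $ i)))" (is "_ \<longleftrightarrow> (\<exists>p. ?P p)")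
proof -
  have *: "solvable \<sigma> \<rho> \<Theta> \<gamma> t \<longleftrightarrow> (\<exists>x y. (x, y) \<noteq> (0, 0) \<and> (\<forall>j. \<bar>real_vec x $ j\<bar> \<le> t powr (\<sigma> $ j)) \<and>
    (\<forall>i. \<bar>(\<Theta> *v real_vec x - real_vec y) $ i\<bar> \<le> t powr (- \<gamma> * \<rho> $ i)))"
    unfolding solvable_def using assms by (simp add: weighted_norm_le_iff powr_powr)
  show ?thesis
  proof
    assume "solvable \<sigma> \<rho> \<Theta> \<gamma> t"
    then obtain x y where xy: "(x, y) \<noteq> (0, 0)" "\<forall>j. \<bar>real_vec x $ j\<bar> \<le> t powr (\<sigma> $ j)"
      "\<forall>i. \<bar>(\<Theta> *v real_vec x - real_vec y) $ i\<bar> \<le> t powr (- \<gamma> * \<rho> $ i)"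
      unfolding * by blast
    define p where "p = (\<chi> k. case k of Inl j \<Rightarrow> x $ j | Inr i \<Rightarrow> y $ i)"
    have "?P p"
      using xy by (auto simp: p_def vec_eq_sum_iff vec_eq_iff matrix_vector_mult_def)
    then show "\<exists>p. ?P p" by blast
  next
    assume "\<exists>p. ?P p"
    then obtain p where p: "?P p" by blast
    show "solvable \<sigma> \<rho> \<Theta> \<gamma> t"
      unfolding *
      by (rule exI[of _ "\<chi> j. p $ Inl j"], rule exI[of _ "\<chi> i. p $ Inr i"])
         (use p in \<open>auto simp: vec_eq_sum_iff vec_eq_iff matrix_vector_mult_def\<close>)
  qed
qed

lemma solvable_transpose_if_dual_forms:
  assumes "\<And>j. \<sigma> $ j > 0" "\<And>i. \<rho> $ i > 0" "t > 0" "q \<noteq> 0"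
    and "\<And>i. \<bar>dual_forms \<Theta> (real_vec q) $ Inr i\<bar> \<le> t powr (\<rho> $ i)"
    and "\<And>j. \<bar>dual_forms \<Theta> (real_vec q) $ Inl j\<bar> \<le> t powr (- \<gamma> * \<sigma> $ j)"
  shows "solvable \<rho> \<sigma> (transpose \<Theta>) \<gamma> t"
proof -
  define x where "x = (\<chi> i. q $ Inr i)"
  define y where "y = (\<chi> j. - q $ Inl j)"
  have eq: "(transpose \<Theta> *v real_vec x - real_vec y) $ j = - dual_forms \<Theta> (real_vec q) $ Inl j" for j
    by (simp add: x_def y_def matrix_vector_mult_def transpose_def)
  have "(x, y) \<noteq> (0, 0)"
    using assms(4) by (auto simp: vec_eq_sum_iff vec_eq_iff x_def y_def)
  moreover have "weighted_norm \<rho> (real_vec x) \<le> t"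
    using assms by (auto simp: weighted_norm_le_iff x_def)
  moreover have "weighted_norm \<sigma> (transpose \<Theta> *v real_vec x - real_vec y) \<le> t powr (- \<gamma>)"
  proof (rule weighted_norm_le_iff[THEN iffD2, rule_format])
    fix j
    show "\<bar>(transpose \<Theta> *v real_vec x - real_vec y) $ j\<bar> \<le> (t powr (- \<gamma>)) powr (\<sigma> $ j)"
      using assms(6)[of j] unfolding eq powr_powr abs_minus_cancel .
  qed (use assms in auto)
  ultimately show ?thesis unfolding solvable_def by blast
qed

section \<open>Transference for exponents\<close>

lemma weightsD:
  assumes "weights \<sigma>"
  shows "\<sigma> $ j > 0" "(\<Sum>j\<in>UNIV. \<sigma> $ j) = 1" "last_entry \<sigma> \<le> \<sigma> $ j" "last_entry \<sigma> > 0"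
proof -
  show pos: "\<sigma> $ j > 0" for j using assms by (simp add: weights_def)
  then show "last_entry \<sigma> > 0" by (simp add: last_entry_def)
  show "(\<Sum>j\<in>UNIV. \<sigma> $ j) = 1" using assms by (simp add: weights_def)
  have "antimono (\<lambda>j. \<sigma> $ j)" using assms by (simp add: weights_def)
  from antimonoD[OF this, of j "Max UNIV"] show "last_entry \<sigma> \<le> \<sigma> $ j"
    by (simp add: last_entry_def)
qed

lemma last_entry_CARD_1:
  fixes \<sigma> :: "real ^ 'k::{finite,linorder}"
  assumes "weights \<sigma>" "CARD('k) = 1"
  shows "last_entry \<sigma> = 1"
proof -
  obtain x where x: "(UNIV :: 'k set) = {x}"
    using assms(2) card_1_singletonE by blast
  then have "last_entry \<sigma> = \<sigma> $ x"
    by (metis UNIV_I last_entry_def singletonD)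
  moreover have "(\<Sum>j\<in>{x}. \<sigma> $ j) = 1"
    using weightsD(2)[OF assms(1)] unfolding x .
  ultimately show ?thesis by simp
qed

lemma last_entry_less_1:
  fixes \<sigma> :: "real ^ 'k::{finite,linorder}"
  assumes "weights \<sigma>" "CARD('k) \<noteq> 1"
  shows "last_entry \<sigma> < 1"
proof -
  let ?M = "Max (UNIV :: 'k set)"
  have "UNIV - {?M} \<noteq> {}"
  proof
    assume "UNIV - {?M} = {}"
    then have "(UNIV :: 'k set) = {?M}" by blast
    then have "card (UNIV :: 'k set) = card {?M}" by (rule arg_cong)
    with assms(2) show False by simp
  qed
  then have "0 < (\<Sum>j\<in>UNIV - {?M}. \<sigma> $ j)"
    using assms(1) by (intro sum_pos) (auto simp: weightsD)
  moreover have "(\<Sum>j\<in>UNIV. \<sigma> $ j) = \<sigma> $ ?M + (\<Sum>j\<in>UNIV - {?M}. \<sigma> $ j)"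
    by (rule sum.remove) auto
  ultimately show ?thesis
    using weightsD(2)[OF assms(1)] by (simp add: last_entry_def)
qed

text \<open>
The exponent arithmetic behind the choice of \<open>g'\<close>. The difference of the two sides of the second
conclusion is affine in \<open>\<nu>\<close>, so it suffices to look at the endpoints \<open>0\<close> and \<open>g' - 1\<close>: there
the inequality follows from \<open>C2\<close> and from \<open>C1\<close>, respectively.
\<close>

lemma transference_exponents:
  fixes s r g g' \<nu> :: real
  assumes "s > 0" "r > 0" "g > 0" "0 \<le> \<nu>" "\<nu> \<le> g' - 1"
    and C1: "g' * (1 - s) \<le> 1 - s / g" and C2: "g' * (1 - r * g) \<le> 1 - r"
  shows "1 - g * (g' - \<nu> / s) \<le> 0" "r * (1 - g * (g' - \<nu> / s)) \<le> 1 - g' + \<nu>" "1 / g \<le> g' - \<nu> / s"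
proof -
  have "g' - 1 \<le> s * (g' - 1 / g)"
    using C1 by (simp add: algebra_simps)
  then have e: "(g' - 1) / s \<le> g' - 1 / g"
    using \<open>s > 0\<close> by (simp add: field_simps)
  moreover have "\<nu> / s \<le> (g' - 1) / s"
    using assms by (simp add: divide_right_mono)
  ultimately show 3: "1 / g \<le> g' - \<nu> / s" by linarith
  have le: "1 - g * (g' - x) \<le> 0" if "x \<le> g' - 1 / g" for x
    using that \<open>g > 0\<close> mult_left_mono[of "1 / g" "g' - x" g] by auto
  from 3 show 1: "1 - g * (g' - \<nu> / s) \<le> 0" by (intro le) linarith
  define a where "a = r * g / s"
  have lin: "r * (1 - g * (g' - x / s)) - (1 - g' + x) = r * (1 - g * g') - (1 - g') + (a - 1) * x" for x
    by (simp add: a_def algebra_simps)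
  show "r * (1 - g * (g' - \<nu> / s)) \<le> 1 - g' + \<nu>"
  proof (cases "a \<le> 1")
    case True
    then have "(a - 1) * \<nu> \<le> 0" using \<open>0 \<le> \<nu>\<close> by (simp add: mult_nonpos_nonneg)
    moreover have "r * (1 - g * g') - (1 - g') \<le> 0"
      using C2 by (simp add: algebra_simps)
    ultimately show ?thesis using lin[of \<nu>] by linarith
  next
    case False
    then have "(a - 1) * \<nu> \<le> (a - 1) * (g' - 1)"
      using assms by (intro mult_left_mono) auto
    moreover have "r * (1 - g * (g' - (g' - 1) / s)) \<le> 0"
      using le[OF e] \<open>r > 0\<close> by (simp add: mult_nonneg_nonpos)
    ultimately show ?thesis using lin[of \<nu>] lin[of "g' - 1"] by linarith
  qed
qed

text \<open>
Transference for a single \<open>T\<close>, up to a constant factor. With \<open>\<eta>\<close> the side lengths of the desired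
dual box, whose product is \<open>T powr (1 - g')\<close>, the solution of the given system at
\<open>t = T powr (g' - \<nu> / last_entry \<sigma>)\<close> is the point which \<open>small_dual_vector\<close> requires for
\<open>V = T powr (- \<nu>)\<close>. Each scaled coordinate is bounded by its weight-th power of a quantity which
is at most 1, so the smallest weights give the largest bounds; this is why only the last weights
enter.
\<close>

lemma transference_box:
  fixes \<sigma> :: "real ^ 'm::{finite,linorder}" and \<rho> :: "real ^ 'n::{finite,linorder}"
    and \<Theta> :: "(real ^ 'm::{finite,linorder}) ^ 'n::{finite,linorder}"
  assumes card: "CARD('m) + CARD('n) \<ge> 3" and w: "weights \<sigma>" "weights \<rho>"
    and g: "g > 0" "g' \<ge> 1"
    and C1: "g' * (1 - last_entry \<sigma>) \<le> 1 - last_entry \<sigma> / g"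
    and C2: "g' * (1 - last_entry \<rho> * g) \<le> 1 - last_entry \<rho>"
    and T: "T > 1"
    and solv: "\<And>t. T powr (1 / g) \<le> t \<Longrightarrow> solvable \<sigma> \<rho> \<Theta> g t"
  shows "\<exists>q. q \<noteq> 0 \<and>
    (\<forall>j. \<bar>dual_forms \<Theta> (real_vec q) $ Inl j\<bar> \<le> 17 * (real CARD('m + 'n))\<^sup>2 * T powr (- g' * \<sigma> $ j)) \<and>
    (\<forall>i. \<bar>dual_forms \<Theta> (real_vec q) $ Inr i\<bar> \<le> 17 * (real CARD('m + 'n))\<^sup>2 * T powr (\<rho> $ i))"
proof -
  define \<eta> where "\<eta> k = (case k of Inl j \<Rightarrow> T powr (- g' * \<sigma> $ j) | Inr i \<Rightarrow> T powr (\<rho> $ i))" for k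
  have \<eta>: "\<eta> k > 0" for k using T by (auto simp: \<eta>_def split: sum.split)
  have \<delta>: "(\<Prod>k\<in>UNIV. \<eta> k) = T powr (1 - g')"
  proof -
    have "(\<Prod>k\<in>UNIV. \<eta> k) = T powr (\<Sum>j\<in>UNIV. - g' * \<sigma> $ j) * T powr (\<Sum>i\<in>UNIV. \<rho> $ i)"
      using T by (simp add: prod_UNIV_sum \<eta>_def powr_sum)
    also have "(\<Sum>j\<in>UNIV. - g' * \<sigma> $ j) = - g'"
      using weightsD(2)[OF w(1)] by (simp add: sum_distrib_left[symmetric] sum_negf)
    finally have "(\<Prod>k\<in>UNIV. \<eta> k) = T powr (- g') * T powr 1"
      using weightsD(2)[OF w(2)] by simp
    then show ?thesis by (simp only: powr_add[symmetric]) simp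
  qed
  have "\<exists>q. q \<noteq> 0 \<and> (\<forall>k. \<bar>dual_forms \<Theta> (real_vec q) $ k\<bar> \<le> 17 * (real CARD('m + 'n))\<^sup>2 * \<eta> k)"
  proof (rule small_dual_vector[where Z = "primal_forms \<Theta>" and A = "range Inl"])
    show "x = 0" if "primal_forms \<Theta> x = 0" for x
      using that primal_forms_involution[of \<Theta> x] linear_0[OF linear_primal_forms, of \<Theta>] by metis
    show "dual_forms \<Theta> (real_vec q) \<bullet> primal_forms \<Theta> (real_vec p) \<in> \<int>" for p q
      by (simp add: dual_forms_inner_primal_forms inner_real_vec_Ints)
    show "(\<Prod>k\<in>UNIV. \<eta> k) \<le> 1"
      unfolding \<delta> using T g powr_mono[of "1 - g'" 0 T] by simp
    show "CARD('m + 'n) \<ge> 3" using card by simp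
  next
    fix V assume V: "(\<Prod>k\<in>UNIV. \<eta> k) \<le> V" "V \<le> 1"
    define \<nu> where "\<nu> = - log T V"
    have "V > 0" using V(1) \<eta> prod_pos[of UNIV \<eta>] by auto
    then have V_eq: "V = T powr (- \<nu>)" using T by (simp add: \<nu>_def)
    have \<nu>: "0 \<le> \<nu>" "\<nu> \<le> g' - 1"
    proof -
      show "0 \<le> \<nu>" using V(2) \<open>V > 0\<close> T by (simp add: \<nu>_def)
      have "T powr (1 - g') \<le> T powr (- \<nu>)" using V(1) unfolding \<delta> V_eq .
      then have "1 - g' \<le> - \<nu>" using T by simp
      then show "\<nu> \<le> g' - 1" by simp
    qed
    let ?s = "last_entry \<sigma>" and ?r = "last_entry \<rho>"
    note ex = transference_exponents[OF weightsD(4)[OF w(1)] weightsD(4)[OF w(2)] g(1) \<nu> C1 C2]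
    define t where "t = T powr (g' - \<nu> / ?s)"
    have "T powr (1 / g) \<le> t" unfolding t_def using ex(3) T by (intro powr_mono) auto
    then have "solvable \<sigma> \<rho> \<Theta> g t" by (rule solv)
    moreover have "t > 0" using T by (simp add: t_def)
    ultimately obtain p where p: "p \<noteq> 0"
      "\<And>j. \<bar>primal_forms \<Theta> (real_vec p) $ Inl j\<bar> \<le> t powr (\<sigma> $ j)"
      "\<And>i. \<bar>primal_forms \<Theta> (real_vec p) $ Inr i\<bar> \<le> t powr (- g * \<rho> $ i)"
      using w by (subst (asm) solvable_iff_primal_forms) (auto simp: weightsD simp del: forms_nth)
    have "\<bar>primal_forms \<Theta> (real_vec p) $ Inl j\<bar> * \<eta> (Inl j) \<le> V" for j
    proof -
      have "\<bar>primal_forms \<Theta> (real_vec p) $ Inl j\<bar> * \<eta> (Inl j) \<le> t powr (\<sigma> $ j) * T powr (- g' * \<sigma> $ j)"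
        using p(2)[of j] by (simp add: \<eta>_def mult_right_mono del: forms_nth)
      also have "\<dots> = T powr (- \<nu> * (\<sigma> $ j / ?s))"
        by (simp add: t_def powr_powr powr_add[symmetric] algebra_simps)
      also have "\<dots> \<le> T powr (- \<nu>)"
      proof (intro powr_mono)
        have "\<nu> * 1 \<le> \<nu> * (\<sigma> $ j / ?s)"
          using \<nu> weightsD(3,4)[OF w(1)] by (intro mult_left_mono) auto
        then show "- \<nu> * (\<sigma> $ j / ?s) \<le> - \<nu>" by simp
      qed (use T in auto)
      finally show ?thesis unfolding V_eq .
    qed
    moreover have "\<bar>primal_forms \<Theta> (real_vec p) $ Inr i\<bar> * \<eta> (Inr i) \<le> (\<Prod>k\<in>UNIV. \<eta> k) / V" for i
    proof -
      have "\<bar>primal_forms \<Theta> (real_vec p) $ Inr i\<bar> * \<eta> (Inr i) \<le> t powr (- g * \<rho> $ i) * T powr (\<rho> $ i)"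
        using p(3)[of i] by (simp add: \<eta>_def mult_right_mono del: forms_nth)
      also have "\<dots> = T powr (\<rho> $ i * (1 - g * (g' - \<nu> / ?s)))"
        by (simp add: t_def powr_powr powr_add[symmetric] algebra_simps)
      also have "\<dots> \<le> T powr (?r * (1 - g * (g' - \<nu> / ?s)))"
        using T weightsD(3)[OF w(2)] ex(1) by (intro powr_mono mult_right_mono_neg) auto
      also have "\<dots> \<le> T powr (1 - g' + \<nu>)"
        using T ex(2) by (intro powr_mono) auto
      also have "\<dots> = (\<Prod>k\<in>UNIV. \<eta> k) / V"
        unfolding \<delta> V_eq using T by (simp add: powr_diff[symmetric])
      finally show ?thesis .
    qed
    moreover have "- range Inl = (range Inr :: ('m + 'n) set)" by (auto, metis sum.exhaust rangeI)
    ultimately show "\<exists>p. p \<noteq> 0 \<and>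
      (\<forall>k\<in>range Inl. \<bar>primal_forms \<Theta> (real_vec p) $ k\<bar> * \<eta> k \<le> V) \<and>
      (\<forall>k\<in>- range Inl. \<bar>primal_forms \<Theta> (real_vec p) $ k\<bar> * \<eta> k \<le> (\<Prod>k\<in>UNIV. \<eta> k) / V)"
      using p(1) by (intro exI[of _ p]) (simp del: forms_nth)
  qed (use \<eta> in \<open>auto simp: linear_primal_forms linear_dual_forms dual_forms_involution\<close>)
  then obtain q where "q \<noteq> 0" and q: "\<And>k. \<bar>dual_forms \<Theta> (real_vec q) $ k\<bar> \<le> 17 * (real CARD('m + 'n))\<^sup>2 * \<eta> k"
    by blast
  with q[of "Inl _"] q[of "Inr _"] show ?thesis
    unfolding \<eta>_def by (intro exI[of _ q]) (simp del: forms_nth)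
qed

lemma eventually_le_powr: "e > 0 \<Longrightarrow> eventually (\<lambda>t :: real. c \<le> t powr e) at_top"
proof -
  assume e: "e > 0"
  have "c \<le> t powr e" if "max c 1 powr (1 / e) \<le> t" for t
  proof -
    have "max c 1 = (max c 1 powr (1 / e)) powr e" using e by (simp add: powr_powr)
    also have "\<dots> \<le> t powr e" using that e by (intro powr_mono2) auto
    finally show ?thesis by simp
  qed
  then show ?thesis by (auto simp: eventually_at_top_linorder)
qed

text \<open>
The constant factor in \<open>transference_box\<close> is absorbed by taking \<open>T = t / \<kappa>\<close>, with \<open>\<kappa>\<close> chosen
according to the smallest weight \<open>last_entry \<rho>\<close>, and by the passage from \<open>g'\<close> to a smaller \<open>h\<close>.
\<close>

lemma eventually_solvable_transpose:
  fixes \<sigma> :: "real ^ 'm::{finite,linorder}" and \<rho> :: "real ^ 'n::{finite,linorder}"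
    and \<Theta> :: "(real ^ 'm::{finite,linorder}) ^ 'n::{finite,linorder}"
  assumes card: "CARD('m) + CARD('n) \<ge> 3" and w: "weights \<sigma>" "weights \<rho>"
    and g: "g > 0" "g' \<ge> 1" "h < g'"
    and C1: "g' * (1 - last_entry \<sigma>) \<le> 1 - last_entry \<sigma> / g"
    and C2: "g' * (1 - last_entry \<rho> * g) \<le> 1 - last_entry \<rho>"
    and solv: "eventually (solvable \<sigma> \<rho> \<Theta> g) at_top"
  shows "eventually (solvable \<rho> \<sigma> (transpose \<Theta>) h) at_top"
proof -
  obtain t0 where t0: "\<And>t. t \<ge> t0 \<Longrightarrow> solvable \<sigma> \<rho> \<Theta> g t"
    using solv by (auto simp: eventually_at_top_linorder)
  define C where "C = 17 * (real CARD('m + 'n))\<^sup>2"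
  have "1 \<le> (real CARD('m + 'n))\<^sup>2" using card by (intro one_le_power) simp
  then have C: "C \<ge> 1" unfolding C_def by linarith
  let ?r = "last_entry \<rho>"
  define \<kappa> where "\<kappa> = C powr (1 / ?r)"
  have r: "?r > 0" using weightsD(4)[OF w(2)] .
  have \<kappa>: "\<kappa> > 0" using C by (simp add: \<kappa>_def)
  have "eventually (\<lambda>t. t > \<kappa>) at_top" by (rule eventually_gt_at_top)
  moreover have "eventually (\<lambda>t. t0 * \<kappa> powr (1 / g) \<le> t powr (1 / g)) at_top"
    using g by (intro eventually_le_powr) auto
  moreover have "eventually (\<lambda>t. \<forall>j. C * \<kappa> powr (g' * \<sigma> $ j) \<le> t powr ((g' - h) * \<sigma> $ j)) at_top"
    using g weightsD(1)[OF w(1)] by (intro eventually_all_finite eventually_le_powr) auto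
  ultimately show ?thesis
  proof eventually_elim
    case (elim t)
    define T where "T = t / \<kappa>"
    have t: "t > 0" using elim \<kappa> by simp
    have T: "T > 1" using elim \<kappa> by (simp add: T_def)
    have "t0 \<le> T powr (1 / g)"
      using elim(2) \<kappa> t by (simp add: T_def powr_divide field_simps)
    then have "\<And>s. T powr (1 / g) \<le> s \<Longrightarrow> solvable \<sigma> \<rho> \<Theta> g s" using t0 by auto
    from transference_box[OF card w g(1,2) C1 C2 T this] obtain q where q: "q \<noteq> 0"
      "\<And>j. \<bar>dual_forms \<Theta> (real_vec q) $ Inl j\<bar> \<le> C * T powr (- g' * \<sigma> $ j)"
      "\<And>i. \<bar>dual_forms \<Theta> (real_vec q) $ Inr i\<bar> \<le> C * T powr (\<rho> $ i)"
      unfolding C_def by (auto simp del: forms_nth)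
    show "solvable \<rho> \<sigma> (transpose \<Theta>) h t"
    proof (rule solvable_transpose_if_dual_forms)
      fix i
      have "C powr 1 \<le> C powr (\<rho> $ i / ?r)"
        using C r weightsD(3)[OF w(2), of i] by (intro powr_mono) auto
      also have "\<dots> = \<kappa> powr (\<rho> $ i)" by (simp add: \<kappa>_def powr_powr)
      finally have "C * T powr (\<rho> $ i) \<le> \<kappa> powr (\<rho> $ i) * T powr (\<rho> $ i)"
        using C by (intro mult_right_mono) auto
      also have "\<dots> = t powr (\<rho> $ i)"
        using \<kappa> t by (simp add: T_def powr_divide)
      finally show "\<bar>dual_forms \<Theta> (real_vec q) $ Inr i\<bar> \<le> t powr (\<rho> $ i)"
        using q(3)[of i] by linarith
    next
      fix j
      have "C * T powr (- g' * \<sigma> $ j) = C * \<kappa> powr (g' * \<sigma> $ j) * t powr (- g' * \<sigma> $ j)"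
        using \<kappa> t by (simp add: T_def powr_divide powr_minus field_simps)
      also have "\<dots> \<le> t powr ((g' - h) * \<sigma> $ j) * t powr (- g' * \<sigma> $ j)"
        using elim(3) by (intro mult_right_mono) auto
      also have "\<dots> = t powr (- h * \<sigma> $ j)"
        by (simp add: powr_add[symmetric] algebra_simps)
      finally show "\<bar>dual_forms \<Theta> (real_vec q) $ Inl j\<bar> \<le> t powr (- h * \<sigma> $ j)"
        using q(2)[of j] by linarith
    qed (use q t w in \<open>auto simp: weightsD\<close>)
  qed
qed

section \<open>Uniform exponents\<close>

text \<open>
The weighted form of Dirichlet's theorem, for exponents strictly below 1.
\<close>

lemma solvable_of_less_1:
  fixes \<sigma> :: "real ^ 'm::{finite,linorder}" and \<rho> :: "real ^ 'n::{finite,linorder}"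
  assumes w: "weights \<sigma>" "weights \<rho>" and g: "g < 1" and t: "t > 1"
  shows "solvable \<sigma> \<rho> \<Theta> g t"
proof -
  define c where "c k = (case k of Inl j \<Rightarrow> t powr (\<sigma> $ j) | Inr i \<Rightarrow> t powr (- g * \<rho> $ i))" for k
  have c: "c k > 0" for k using t by (auto simp: c_def split: sum.split)
  have "(\<Prod>k\<in>UNIV. c k) = t powr (\<Sum>j\<in>UNIV. \<sigma> $ j) * t powr (\<Sum>i\<in>UNIV. - g * \<rho> $ i)"
    using t by (simp add: prod_UNIV_sum c_def powr_sum)
  also have "(\<Sum>i\<in>UNIV. - g * \<rho> $ i) = - g"
    using weightsD(2)[OF w(2)] by (simp add: sum_distrib_left[symmetric] sum_negf)
  also have "t powr (\<Sum>j\<in>UNIV. \<sigma> $ j) * t powr (- g) = t powr (1 - g)"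
    unfolding weightsD(2)[OF w(1)] powr_add[symmetric] by simp
  also have "\<dots> > 1"
    using t g by (simp add: gr_one_powr)
  finally obtain p v where p: "p \<noteq> 0" "real_vec p = primal_forms \<Theta> v" "\<And>k. \<bar>v $ k\<bar> \<le> c k"
    using minkowski_parallelepiped[of "primal_forms \<Theta>" c] c
      linear_primal_forms abs_det_involution primal_forms_involution by metis
  have "primal_forms \<Theta> (real_vec p) = v"
    unfolding p(2) by (rule primal_forms_involution)
  with p(1) p(3)[of "Inl _"] p(3)[of "Inr _"] show ?thesis
    using t w by (subst solvable_iff_primal_forms) (auto simp: weightsD c_def simp del: forms_nth)
qed

lemma uniform_exponent_geI:
  assumes "\<And>h. h < g \<Longrightarrow> eventually (solvable \<sigma> \<rho> \<Theta> h) at_top"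
  shows "ereal g \<le> uniform_exponent \<sigma> \<rho> \<Theta>"
proof (rule dense_le)
  fix y assume "y < ereal g"
  then obtain h where h: "y < ereal h" "ereal h < ereal g"
    using ereal_dense2 by blast
  then have "ereal h \<le> uniform_exponent \<sigma> \<rho> \<Theta>"
    unfolding uniform_exponent_def using assms[of h] by (intro Sup_upper) auto
  with h(1) show "y \<le> uniform_exponent \<sigma> \<rho> \<Theta>" by simp
qed

lemma eventually_solvable_of_less_uniform_exponent:
  assumes "ereal g < uniform_exponent \<sigma> \<rho> \<Theta>"
  shows "eventually (solvable \<sigma> \<rho> \<Theta> g) at_top"
proof -
  obtain h where h: "g < h" "eventually (solvable \<sigma> \<rho> \<Theta> h) at_top"
    using assms unfolding uniform_exponent_def less_Sup_iff by auto
  from h(2) eventually_ge_at_top[of 1] show ?thesis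
  proof eventually_elim
    case (elim t)
    then have "t powr (- h) \<le> t powr (- g)" using h(1) by (intro powr_mono) auto
    with elim(1) show ?case unfolding solvable_def by (meson order_trans)
  qed
qed

lemma uniform_exponent_ge_1:
  fixes \<sigma> :: "real ^ 'm::{finite,linorder}" and \<rho> :: "real ^ 'n::{finite,linorder}"
  assumes "weights \<sigma>" "weights \<rho>"
  shows "1 \<le> uniform_exponent \<sigma> \<rho> \<Theta>"
  unfolding one_ereal_def
  using assms by (intro uniform_exponent_geI eventually_mono[OF eventually_gt_at_top[of 1]] solvable_of_less_1)

lemma ereal_le_of_at_left:
  fixes f :: "real \<Rightarrow> real"
  assumes "isCont f w" "l < w" "\<And>g. l < g \<Longrightarrow> g < w \<Longrightarrow> ereal (f g) \<le> X"
  shows "ereal (f w) \<le> X"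
proof (rule tendsto_upperbound[where F = "at_left w"])
  have "(f \<longlongrightarrow> f w) (at_left w)"
    using assms(1) by (simp add: continuous_at filterlim_at_split)
  then show "((\<lambda>g. ereal (f g)) \<longlongrightarrow> ereal (f w)) (at_left w)" by simp
  show "eventually (\<lambda>g. ereal (f g) \<le> X) (at_left w)"
    using assms(2,3) by (auto simp: eventually_at_left_field)
qed simp

text \<open>
The two values of \<open>g'\<close> in the transference inequality. Each turns one of the two conditions on
\<open>g'\<close> into an equality, and the other condition then amounts to \<open>s \<le> r * g\<close>, respectively
\<open>r * g \<le> s\<close>.
\<close>

lemma transference_exponent_large:
  fixes s r g :: real
  assumes "0 < s" "s < 1" "1 \<le> g" "s \<le> r * g"
  defines "g' \<equiv> (1 - s / g) / (1 - s)"
  shows "g' \<ge> 1" "g' * (1 - s) \<le> 1 - s / g" "g' * (1 - r * g) \<le> 1 - r"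
proof -
  have "s / g \<le> s / 1" using assms by (intro divide_left_mono) auto
  then show "g' \<ge> 1" using assms by (simp add: g'_def)
  show "g' * (1 - s) \<le> 1 - s / g" using assms by (simp add: g'_def)
  have "0 \<le> (g - 1) * (r * g - s)" using assms by simp
  then have "(g - s) * (1 - r * g) \<le> (1 - r) * (1 - s) * g"
    by (simp add: algebra_simps)
  then have "(g - s) * (1 - r * g) / (g * (1 - s)) \<le> 1 - r"
    using assms by (simp add: pos_divide_le_eq mult_ac)
  moreover have "g' = (g - s) / (g * (1 - s))"
    using assms by (simp add: g'_def field_simps)
  ultimately show "g' * (1 - r * g) \<le> 1 - r" by simp
qed

lemma transference_exponent_small:
  fixes s r g :: real
  assumes "0 < r" "1 \<le> g" "r * g \<le> s" "r * g < 1"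
  defines "g' \<equiv> (1 - r) / (1 - r * g)"
  shows "g' \<ge> 1" "g' * (1 - s) \<le> 1 - s / g" "g' * (1 - r * g) \<le> 1 - r"
proof -
  have "r * 1 \<le> r * g" using assms by (intro mult_left_mono) auto
  then show "g' \<ge> 1" using assms by (simp add: g'_def)
  show "g' * (1 - r * g) \<le> 1 - r" using assms by (simp add: g'_def)
  have "0 \<le> (g - 1) * (s - r * g)" using assms by simp
  then have "(1 - r) * (1 - s) * g \<le> (g - s) * (1 - r * g)"
    by (simp add: algebra_simps)
  then have "(1 - r) * (1 - s) \<le> (1 - s / g) * (1 - r * g)"
    using assms by (simp add: field_simps)
  then show "g' * (1 - s) \<le> 1 - s / g"
    using assms by (simp add: g'_def pos_divide_le_eq)
qed

theorem theorem2:
  fixes \<sigma> :: "real ^ 'm::{finite,linorder}"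
    and \<rho> :: "real ^ 'n::{finite,linorder}"
    and \<Theta> :: "(real ^ 'm::{finite,linorder}) ^ 'n::{finite,linorder}"
  assumes "CARD('m) + CARD('n) \<ge> 3"
    and "weights \<sigma>"
    and "weights \<rho>"
  shows "let \<omega> = uniform_exponent \<sigma> \<rho> \<Theta>;
             \<omega>\<^sub>T = uniform_exponent \<rho> \<sigma> (transpose \<Theta>);
             \<sigma>\<^sub>m = last_entry \<sigma>;
             \<rho>\<^sub>n = last_entry \<rho>
         in (\<omega> \<ge> ereal (\<sigma>\<^sub>m / \<rho>\<^sub>n) \<longrightarrow>
               \<omega>\<^sub>T \<ge> (if CARD('m) = 1 then \<infinity>
                      else (1 - ereal \<sigma>\<^sub>m * inverse \<omega>) / (1 - ereal \<sigma>\<^sub>m))) \<and>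
            (\<omega> \<le> ereal (\<sigma>\<^sub>m / \<rho>\<^sub>n) \<longrightarrow>
               \<omega>\<^sub>T \<ge> (1 - ereal \<rho>\<^sub>n) / (1 - ereal \<rho>\<^sub>n * \<omega>))"
proof -
  note w = assms(2,3)
  define \<omega> where "\<omega> = uniform_exponent \<sigma> \<rho> \<Theta>"
  define X where "X = uniform_exponent \<rho> \<sigma> (transpose \<Theta>)"
  define s where "s = last_entry \<sigma>"
  define r where "r = last_entry \<rho>"
  have s: "0 < s" and r: "0 < r"
    using w weightsD(4) by (auto simp: s_def r_def)
  have \<omega>1: "1 \<le> \<omega>" and X1: "1 \<le> X"
    unfolding \<omega>_def X_def using w uniform_exponent_ge_1 by auto
  have transfer: "ereal g' \<le> X"
    if "1 \<le> g" "ereal g < \<omega>" "1 \<le> g'" "g' * (1 - s) \<le> 1 - s / g" "g' * (1 - r * g) \<le> 1 - r" for g g'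
    unfolding X_def
  proof (rule uniform_exponent_geI)
    fix h assume "h < g'"
    then show "eventually (solvable \<rho> \<sigma> (transpose \<Theta>) h) at_top"
      using eventually_solvable_transpose[OF assms(1) w, of g g' h \<Theta>] that
        eventually_solvable_of_less_uniform_exponent[of g \<sigma> \<rho> \<Theta>]
      by (auto simp: \<omega>_def s_def r_def)
  qed
  have large: "ereal ((1 - s / g) / (1 - s)) \<le> X" if "s < 1" "1 \<le> g" "s \<le> r * g" "ereal g < \<omega>" for g
    using transfer[of g "(1 - s / g) / (1 - s)"] transference_exponent_large[of s g r] that s by blast
  have small: "ereal ((1 - r) / (1 - r * g)) \<le> X" if "1 \<le> g" "r * g \<le> s" "r * g < 1" "ereal g < \<omega>" for g
    using transfer[of g "(1 - r) / (1 - r * g)"] transference_exponent_small[of r g s] that r by blast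
  have small_limit: "ereal ((1 - r) / (1 - r * v)) \<le> X"
    if v: "1 < v" "r * v \<le> s" "r * v < 1" "\<omega> = ereal v" for v
  proof (rule ereal_le_of_at_left[where f = "\<lambda>g. (1 - r) / (1 - r * g)" and l = 1])
    show "isCont (\<lambda>g. (1 - r) / (1 - r * g)) v"
      using v by (intro continuous_intros) auto
    fix g assume g: "1 < g" "g < v"
    then have "r * g < r * v" using r by simp
    then show "ereal ((1 - r) / (1 - r * g)) \<le> X"
      using v g by (intro small) auto
  qed (use v in auto)
  have m1: "X = \<infinity>" if m: "CARD('m) = 1" and "ereal (s / r) \<le> \<omega>"
  proof -
    have "s = 1" using last_entry_CARD_1[OF w(1) m] by (simp add: s_def)
    have "r < 1" using last_entry_less_1[OF w(2)] assms(1) m by (simp add: r_def)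
    have "ereal B \<le> X" for B
    proof -
      define B' where "B' = max B 1"
      \<comment> \<open>The solution of \<open>(1 - r) / (1 - r * g) = B'\<close>; it tends to \<open>1 / r\<close> as \<open>B'\<close> grows.\<close>
      define g where "g = (1 - (1 - r) / B') / r"
      have rg: "1 - r * g = (1 - r) / B'" using r by (simp add: g_def)
      have B': "1 \<le> B'" by (simp add: B'_def)
      have pos: "(1 - r) / B' > 0" using B' \<open>r < 1\<close> by simp
      have "(1 - r) / B' \<le> (1 - r) / 1" using B' \<open>r < 1\<close> by (intro divide_left_mono) auto
      then have "1 \<le> g" using r by (simp add: g_def pos_le_divide_eq)
      moreover have "g < s / r" using r pos \<open>s = 1\<close> by (simp add: g_def divide_strict_right_mono)
      then have "ereal g < \<omega>" using \<open>ereal (s / r) \<le> \<omega>\<close> by (meson less_ereal.simps(1) less_le_trans)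
      ultimately have "ereal ((1 - r) / (1 - r * g)) \<le> X"
        using rg pos \<open>s = 1\<close> by (intro small) auto
      then have "ereal B' \<le> X" unfolding rg using B' \<open>r < 1\<close> by simp
      moreover have "ereal B \<le> ereal B'" by (simp add: B'_def)
      ultimately show ?thesis by (rule order_trans[rotated])
    qed
    then show ?thesis by (rule ereal_top)
  qed
  have first: "(1 - ereal s * inverse \<omega>) / (1 - ereal s) \<le> X"
    if m: "CARD('m) \<noteq> 1" and le: "ereal (s / r) \<le> \<omega>"
  proof -
    have "s < 1" using last_entry_less_1[OF w(1) m] by (simp add: s_def)
    show ?thesis
    proof (cases \<omega>)
      case PInf
      have "((\<lambda>g. (1 - s / g) / (1 - s)) \<longlongrightarrow> (1 - 0) / (1 - s)) at_top"
        using \<open>s < 1\<close> by (intro tendsto_intros tendsto_divide_0[OF tendsto_const] filterlim_at_top_imp_at_infinity filterlim_ident) auto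
      then have "((\<lambda>g. ereal ((1 - s / g) / (1 - s))) \<longlongrightarrow> ereal (1 / (1 - s))) at_top" by simp
      moreover have "eventually (\<lambda>g. ereal ((1 - s / g) / (1 - s)) \<le> X) at_top"
        using eventually_ge_at_top[of "max 1 (s / r)"]
      proof eventually_elim
        case (elim g)
        then have "s \<le> r * g" using r by (simp add: pos_divide_le_eq mult.commute)
        with elim \<open>s < 1\<close> PInf show ?case by (intro large) auto
      qed
      ultimately have "ereal (1 / (1 - s)) \<le> X"
        by (rule tendsto_upperbound) simp
      then show ?thesis using PInf \<open>s < 1\<close> by (simp add: one_ereal_def)
    next
      case (real v)
      have v: "1 \<le> v" using \<omega>1 real by simp
      have sv: "s / r \<le> v" using le real by simp
      have "ereal ((1 - s / v) / (1 - s)) \<le> X"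
      proof -
        consider "v = 1" | "1 < v" "s / r < v" | "1 < v" "v = s / r" using v sv by linarith
        then show ?thesis
        proof cases
          case 1
          then show ?thesis using X1 \<open>s < 1\<close> by (simp add: one_ereal_def)
        next
          case 2
          show ?thesis
          proof (rule ereal_le_of_at_left[where f = "\<lambda>g. (1 - s / g) / (1 - s)"])
            show "isCont (\<lambda>g. (1 - s / g) / (1 - s)) v"
              using v \<open>s < 1\<close> by (intro continuous_intros) auto
            show "max 1 (s / r) < v" using 2 by simp
            fix g assume g: "max 1 (s / r) < g" "g < v"
            then have "s \<le> r * g" using r by (simp add: pos_divide_less_eq mult.commute)
            then show "ereal ((1 - s / g) / (1 - s)) \<le> X"
              using g \<open>s < 1\<close> real by (intro large) auto
          qed
        next
          case 3
          \<comment> \<open>On the boundary only exponents below \<open>s / r\<close> are at hand; the two bounds agree there.\<close>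
          then have "r * v = s" "s / v = r" using r s by auto
          then show ?thesis using small_limit[of v] 3 \<open>s < 1\<close> real by simp
        qed
      qed
      then show ?thesis using real v \<open>s < 1\<close> by (simp add: one_ereal_def divide_inverse)
    next
      case MInf
      then show ?thesis using \<omega>1 by simp
    qed
  qed
  have second: "(1 - ereal r) / (1 - ereal r * \<omega>) \<le> X" if le: "\<omega> \<le> ereal (s / r)"
  proof -
    obtain v where v: "\<omega> = ereal v" using \<omega>1 le by (cases \<omega>) auto
    have v1: "1 \<le> v" using \<omega>1 v by simp
    have rv: "r * v \<le> s" using le v r by (simp add: pos_le_divide_eq mult.commute)
    show ?thesis
    proof (cases "CARD('m) = 1 \<and> ereal (s / r) \<le> \<omega>")
      case True
      then show ?thesis using m1 by simp
    next
      case False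
      have "r * v < 1"
      proof (cases "CARD('m) = 1")
        case True
        then have "s = 1" using last_entry_CARD_1[OF w(1)] by (simp add: s_def)
        moreover have "v < s / r" using False True v by simp
        ultimately show ?thesis using r by (simp add: pos_less_divide_eq mult.commute)
      next
        case False
        then show ?thesis using last_entry_less_1[OF w(1)] rv by (simp add: s_def)
      qed
      have "ereal ((1 - r) / (1 - r * v)) \<le> X"
      proof (cases "v = 1")
        case True
        then show ?thesis using X1 \<open>r * v < 1\<close> by (simp add: one_ereal_def)
      next
        case False
        then show ?thesis using small_limit[of v] v v1 rv \<open>r * v < 1\<close> by simp
      qed
      then show ?thesis using v \<open>r * v < 1\<close> by (simp add: one_ereal_def)
    qed
  qed
  show ?thesis
    using m1 first second unfolding Let_def \<omega>_def X_def s_def r_def by auto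
qed

end
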